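(* Let $S \subset F$ be a measurable subset such that $0 < \mathfrak{m}(S) < \infty$ and $$\frac{1}{\mathfrak{m}(B(0,q^{-n}))}\int_{B(0,q^{-n})} \mathfrak{m}\big(S \setminus (S+y)\big)\, \mathrm{d}\mathfrak{m}(y) = O(q^{-n}) \quad \text{as } n \to \infty.$$ Then the determinantal point process on $F$ induced by the correlation kernel $K_S(x,y) = \widehat{\mathbf{1}_S}(x-y)$, $x,y\in F$, is number rigid.
   Context: $F$ is a non-discrete non-Archimedean local field, with ring of integers $\mathcal{O}_F = \{x : |x| \le 1\}$, maximal ideal $\mathcal{M}_F = \{x : |x|<1\} = \varpi\mathcal{O}_F$, and residue field $\mathcal{O}_F/\mathcal{M}_F$ of cardinality $q = p^e$ ($p$ prime). The absolute value $|\cdot|$ is normalized by $|\varpi| = q^{-1}$. $\mathfrak{m}$ is the Haar measure on the additive group $F$ with $\mathfrak{m}(\mathcal{O}_F)=1$. $B(x,r) = \{y \in F : |y-x| \le r\}$ denotes the closed ball. $\mathbf{1}_S$ is the indicator function of $S$, and $S+y=\{s+y: s\in S\}$. Fourier transform: fix a character $\chi$ of the additive group $F$ (continuous homomorphism into the unit circle) with $\chi \equiv 1$ on $\mathcal{O}_F$ and $\chi$ not constant on $\varpi^{-1}\mathcal{O}_F$. For $f \in L^1(F,\mathfrak{m})$, $\widehat{f}(y) = \int_F f(x)\chi(xy)\,\mathrm{d}\mathfrak{m}(x)$. Point processes: a random point process $\mathcal{X}$ on $F$ is a random locally finite subset of $F$. It is a determinantal point process induced by a correlation kernel $K : F\times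 F \to \mathbb{C}$ if for every positive integer $n$ and every compactly supported bounded measurable $\varphi : F^n \to \mathbb{C}$, $$\mathbb{E}\Big(\sum^{*}_{x_1,\dots,x_n \in \mathcal{X}} \varphi(x_1,\dots,x_n)\Big) = \int_{F^n} \varphi(y_1,\dots,y_n)\det(K(y_i,y_j))_{1\le i,j\le n}\,\mathrm{d}\mathfrak{m}(y_1)\cdots \mathrm{d}\mathfrak{m}(y_n),$$ where $\sum^*$ is the sum over ordered $n$-tuples of distinct points of $\mathcal{X}$. For measurable $S$ with $0<\mathfrak{m}(S)<\infty$, the kernel $K_S$ induces a determinantal point process (Macchi–Soshnikov theorem). Number rigidity: $\mathcal{X}$ is number rigid if for every bounded open subset $B \subset F$, the number $\#(\mathcal{X}\cap B)$ is almost surely determined by $\mathcal{X}\setminus B$, i.e. it is measurable with respect to the completion of the $\sigma$-algebra generated by $\mathcal{X}\setminus B$. *)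

theory Defs
  imports "HOL-Probability.Probability" "Jordan_Normal_Form.Determinant"
begin

text \<open>
  A non-discrete, locally compact field whose topology is induced by a non-Archimedean absolute
  value. Positivity and definiteness of the absolute value follow from the metric axioms via
  \<open>dist x y = absv (x - y)\<close>; \<^class>\<open>perfect_space\<close> is non-discreteness, and in particular
  excludes the trivial absolute value. The absolute value is only fixed up to a power here;
  see \<open>normalized_uniformizer\<close> below. A new parameter is used since \<open>norm\<close> is constrained to
  real normed vector spaces.
\<close>

class nonarch_local_field = field + metric_space + perfect_space +
  fixes absv :: "'a \<Rightarrow> real"
  assumes dist_absv: "dist x y = absv (x - y)"
    and absv_mult: "absv (x * y) = absv x * absv y"
    and absv_ultrametric: "absv (x + y) \<le> max (absv x) (absv y)"
    and locally_compact: "\<exists>U C. open U \<and> compact C \<and> x \<in> U \<and> U \<subseteq> C"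

definition ring_of_integers :: "'a::nonarch_local_field set" (\<open>\<O>\<^sub>F\<close>)
  where "\<O>\<^sub>F = {x. absv x \<le> 1}"

definition maximal_ideal :: "'a::nonarch_local_field set" (\<open>\<M>\<^sub>F\<close>)
  where "\<M>\<^sub>F = {x. absv x < 1}"

definition residue_field :: "'a::nonarch_local_field set set"
  where "residue_field = \<O>\<^sub>F // {(x, y). x \<in> \<O>\<^sub>F \<and> y \<in> \<O>\<^sub>F \<and> x - y \<in> \<M>\<^sub>F}"

definition uniformizer :: "'a::nonarch_local_field \<Rightarrow> bool"
  where "uniformizer \<pi> \<longleftrightarrow> \<M>\<^sub>F = (\<lambda>x. \<pi> * x) ` \<O>\<^sub>F"

definition normalized_uniformizer :: "'a::nonarch_local_field \<Rightarrow> bool"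
  where "normalized_uniformizer \<pi> \<longleftrightarrow>
    uniformizer \<pi> \<and> absv \<pi> = inverse (real (card (residue_field :: 'a set set)))"

text \<open>
  Regularity is not listed: a locally compact field as above is second countable, so every Borel
  measure that is finite on compact sets is regular.
\<close>

definition normalized_haar :: "'a::nonarch_local_field measure \<Rightarrow> bool"
  where "normalized_haar \<mm> \<longleftrightarrow>
    sets \<mm> = sets borel \<and>
    (\<forall>A\<in>sets borel. \<forall>x. emeasure \<mm> ((\<lambda>a. a + x) ` A) = emeasure \<mm> A) \<and>
    (\<forall>C. compact C \<longrightarrow> emeasure \<mm> C < \<infinity>) \<and>
    emeasure \<mm> \<O>\<^sub>F = 1"

definition additive_character :: "('a::nonarch_local_field \<Rightarrow> complex) \<Rightarrow> bool"
  where "additive_character \<psi> \<longleftrightarrow>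
    continuous_on UNIV \<psi> \<and> (\<forall>x. norm (\<psi> x) = 1) \<and> (\<forall>x y. \<psi> (x + y) = \<psi> x * \<psi> y)"

definition fourier ::
  "'a::nonarch_local_field measure \<Rightarrow> ('a \<Rightarrow> complex) \<Rightarrow> ('a \<Rightarrow> complex) \<Rightarrow> 'a \<Rightarrow> complex"
  where "fourier \<mm> \<psi> f y = (LINT x|\<mm>. f x * \<psi> (x * y))"

definition kernel_of_set ::
  "'a::nonarch_local_field measure \<Rightarrow> ('a \<Rightarrow> complex) \<Rightarrow> 'a set \<Rightarrow> 'a \<Rightarrow> 'a \<Rightarrow> complex"
  where "kernel_of_set \<mm> \<psi> S x y = fourier \<mm> \<psi> (indicator S) (x - y)"

text \<open>
  Bounded sets are exactly the relatively compact ones in a local field, so this is the usual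
  notion of local finiteness.
\<close>

definition locally_finite_set :: "'a::metric_space set \<Rightarrow> bool"
  where "locally_finite_set A \<longleftrightarrow> (\<forall>B. bounded B \<longrightarrow> finite (A \<inter> B))"

text \<open>
  The space of configurations, with the \<open>\<sigma>\<close>-algebra generated by the counting maps
  \<open>A \<mapsto> #(A \<inter> C)\<close> for bounded Borel sets \<open>C\<close>.
\<close>

definition config_space :: "'a::metric_space set measure"
  where "config_space = sigma {A. locally_finite_set A}
    {{A. locally_finite_set A \<and> card (A \<inter> C) = k} | C k. C \<in> sets borel \<and> bounded C}"

definition point_process :: "'w measure \<Rightarrow> ('w \<Rightarrow> 'a::metric_space set) \<Rightarrow> bool"
  where "point_process P X \<longleftrightarrow> prob_space P \<and> X \<in> measurable P config_space"

definition distinct_tuples :: "nat \<Rightarrow> 'a set \<Rightarrow> (nat \<Rightarrow> 'a) set"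
  where "distinct_tuples n A = {x \<in> {..<n} \<rightarrow>\<^sub>E A. inj_on x {..<n}}"

text \<open>
  Elements of \<open>F\<^sup>n\<close> are the extensional functions on \<open>{..<n}\<close>.
\<close>

definition compactly_supported :: "nat \<Rightarrow> ((nat \<Rightarrow> 'a::topological_space) \<Rightarrow> complex) \<Rightarrow> bool"
  where "compactly_supported n \<phi> \<longleftrightarrow>
    (let T = product_topology (\<lambda>_. euclidean) {..<n}
     in compactin T (T closure_of {x \<in> topspace T. \<phi> x \<noteq> 0}))"

text \<open>
  The sum over tuples is an unordered sum over a possibly infinite index set, of which only
  finitely many terms are nonzero. Integrability of both sides is part of the definition, as
  otherwise the convention that non-integrable functions have integral \<open>0\<close> would interfere.
\<close>

definition determinantal ::
  "'w measure \<Rightarrow> ('w \<Rightarrow> 'a set) \<Rightarrow> 'a::metric_space measure \<Rightarrow> ('a \<Rightarrow> 'a \<Rightarrow> complex) \<Rightarrow> bool"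
  where "determinantal P X \<mm> K \<longleftrightarrow>
    point_process P X \<and>
    (\<forall>n>0. \<forall>\<phi>.
      \<phi> \<in> borel_measurable (Pi\<^sub>M {..<n} (\<lambda>_. \<mm>)) \<and>
      bounded (\<phi> ` ({..<n} \<rightarrow>\<^sub>E UNIV)) \<and>
      compactly_supported n \<phi> \<longrightarrow>
      integrable (Pi\<^sub>M {..<n} (\<lambda>_. \<mm>))
        (\<lambda>y. \<phi> y * Determinant.det (Matrix.mat n n (\<lambda>(i, j). K (y i) (y j)))) \<and>
      has_bochner_integral P (\<lambda>\<omega>. \<Sum>\<^sub>\<infinity>x\<in>distinct_tuples n (X \<omega>). \<phi> x)
        (LINT y|Pi\<^sub>M {..<n} (\<lambda>_. \<mm>).
          \<phi> y * Determinant.det (Matrix.mat n n (\<lambda>(i, j). K (y i) (y j)))))"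

text \<open>
  The \<open>\<sigma>\<close>-algebra generated by \<open>X \<setminus> B\<close>, completed by all \<open>P\<close>-negligible sets. It is not enough
  to add the subsets of null sets of the generated \<open>\<sigma>\<close>-algebra itself (i.e. to apply
  \<^const>\<open>completion\<close> to the restricted measure): on the canonical probability space of
  configurations, the null event where \<open>#(X \<inter> B)\<close> differs from a given function of \<open>X \<setminus> B\<close>
  meets every nonempty event generated by \<open>X \<setminus> B\<close>.
\<close>

definition outside_algebra ::
  "'w measure \<Rightarrow> ('w \<Rightarrow> 'a::metric_space set) \<Rightarrow> 'a set \<Rightarrow> 'w measure"
  where "outside_algebra P X B = sigma (space P)
    (sets (vimage_algebra (space P) (\<lambda>\<omega>. X \<omega> - B) config_space) \<union> null_sets (completion P))"

definition number_rigid :: "'w measure \<Rightarrow> ('w \<Rightarrow> 'a::metric_space set) \<Rightarrow> bool"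
  where "number_rigid P X \<longleftrightarrow>
    (\<forall>B. open B \<and> bounded B \<longrightarrow>
      (\<lambda>\<omega>. card (X \<omega> \<inter> B)) \<in> measurable (outside_algebra P X B) (count_space UNIV))"

end

theory Submission
  imports Defs
begin

text \<open>
  Number rigidity follows from the variance method of Ghosh and Peres. Let \<open>N\<^sub>k\<close> be the number of
  points of the process in the ball of radius \<open>q ^ k\<close> about \<open>0\<close>. If some averages of the centred
  variables \<open>N\<^sub>k - E N\<^sub>k\<close>, over balls that all contain a given bounded set \<open>B\<close>, tend to \<open>0\<close> almost
  surely, then \<open>#(X \<inter> B)\<close> can be read off from \<open>X - B\<close>: each \<open>N\<^sub>k\<close> is \<open>#(X \<inter> B)\<close> plus the number of
  points of \<open>X - B\<close> in the ball, so \<open>#(X \<inter> B)\<close> is the limit of averages that depend on \<open>X - B\<close> only.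

  The averages tend to \<open>0\<close> because the \<open>N\<^sub>k\<close> are almost uncorrelated. Put
  \<open>g(t) = \<bar>F(t)\<bar>\<^sup>2\<close>, where \<open>F\<close> is the Fourier transform of the indicator of \<open>S\<close>. The first two
  correlation functions of the process give, for \<open>n \<le> m\<close>,
  \<open>Cov(N\<^sub>n, N\<^sub>m) = q ^ n * \<mm>(S) - \<integral>\<integral> g(x - y)\<close> with \<open>x\<close> in the ball of radius \<open>q ^ n\<close> and \<open>y\<close> in
  the one of radius \<open>q ^ m\<close>. Here the ultrametric inequality enters: the larger ball is a group that
  contains \<open>x\<close>, so the integral over \<open>y\<close> does not depend on \<open>x\<close>, and
  \<open>Cov(N\<^sub>n, N\<^sub>m) = q ^ n * (\<mm>(S) - \<integral> g)\<close> with the integral of \<open>g\<close> over the larger ball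
  (\<open>covariance_count\<close>). A character integrates to \<open>0\<close> over a ball on which it is not trivial, so by
  Fubini this integral is \<open>q ^ m\<close> times the integral of \<open>\<mm>(S \<inter> (S + y))\<close> over the dual ball of
  radius \<open>q ^ (- m)\<close>, which has measure \<open>q ^ (- m)\<close> (\<open>integral_energy_disc\<close>). Hence \<open>\<mm>(S) - \<integral> g\<close>
  is exactly the mean of \<open>\<mm>(S - (S + y))\<close> over the dual ball. By hypothesis it is \<open>O(q ^ (- m))\<close>, so
  the covariance is \<open>O(q ^ (n - m))\<close>.

  Covariances that decay geometrically in \<open>m - n\<close> make the variance of the average of the first \<open>n\<close>
  variables \<open>O(1 / n)\<close>, and convergence in mean square gives almost sure convergence along a
  subsequence (\<open>averages_tendsto_0_subsequence\<close>).
\<close>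

section \<open>Topology of a non-Archimedean local field\<close>

lemma absv_dist_0: "absv (x::'a::nonarch_local_field) = dist x 0"
  by (simp add: dist_absv)

lemma absv_nonneg [simp]: "0 \<le> absv (x::'a::nonarch_local_field)"
  by (simp add: absv_dist_0)

lemma absv_zero_iff [simp]: "absv (x::'a::nonarch_local_field) = 0 \<longleftrightarrow> x = 0"
  by (simp add: absv_dist_0)

lemma absv_zero [simp]: "absv (0::'a::nonarch_local_field) = 0"
  by simp

lemma absv_one [simp]: "absv (1::'a::nonarch_local_field) = 1"
  using absv_mult[of "1::'a" 1] by simp

lemma absv_minus [simp]: "absv (- x) = absv (x::'a::nonarch_local_field)"
  using dist_absv[of x 0] dist_absv[of 0 x] by (simp add: dist_commute)

lemma absv_inverse: "absv (inverse x) = inverse (absv (x::'a::nonarch_local_field))"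
proof (cases "x = 0")
  case False
  then have "absv x * absv (inverse x) = 1"
    by (simp add: absv_mult[symmetric])
  then show ?thesis
    by (metis inverse_unique)
qed simp

lemma absv_power: "absv (x ^ n) = absv (x::'a::nonarch_local_field) ^ n"
  by (induction n) (simp_all add: absv_mult)

lemma absv_power_int: "absv (x powi k) = absv (x::'a::nonarch_local_field) powi k"
  by (simp add: power_int_def absv_power absv_inverse)

lemma mem_cball_0_absv: "x \<in> cball 0 r \<longleftrightarrow> absv (x::'a::nonarch_local_field) \<le> r"
  by (simp add: absv_dist_0 dist_commute)

text \<open>
  The three instances in this section make differences and products of Borel functions with values
  in the field Borel: that argument needs continuous operations and a countable basis.
\<close>

instance nonarch_local_field \<subseteq> topological_ab_group_add
proof
  fix a b :: 'a
  show "LIM x (nhds a \<times>\<^sub>F nhds b). fst x + snd x :> nhds (a + b)"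
  proof (rule metric_tendsto_imp_tendsto[where f = "\<lambda>x. dist (fst x) a + dist (snd x) b" and a = 0])
    show "((\<lambda>x. dist (fst x) a + dist (snd x) b) \<longlongrightarrow> 0) (nhds a \<times>\<^sub>F nhds b)"
      by (rule tendsto_eq_intros tendsto_dist filterlim_fst filterlim_snd refl | simp)+
    show "\<forall>\<^sub>F x in nhds a \<times>\<^sub>F nhds b. dist (fst x + snd x) (a + b) \<le> dist (dist (fst x) a + dist (snd x) b) 0"
    proof (intro always_eventually allI)
      fix x :: "'a \<times> 'a"
      have "dist (fst x + snd x) (a + b) = absv ((fst x - a) + (snd x - b))"
        by (simp add: dist_absv algebra_simps)
      also have "\<dots> \<le> max (absv (fst x - a)) (absv (snd x - b))"
        by (rule absv_ultrametric)
      also have "\<dots> \<le> absv (fst x - a) + absv (snd x - b)"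
        by simp
      finally show "dist (fst x + snd x) (a + b) \<le> dist (dist (fst x) a + dist (snd x) b) 0"
        by (simp add: dist_absv dist_real_def)
    qed
  qed
  show "(uminus \<longlongrightarrow> - a) (nhds a)"
  proof (rule metric_tendsto_imp_tendsto[OF filterlim_ident])
    have "dist (- x) (- a) = dist x a" for x
      using absv_minus[of "x - a"] by (simp add: dist_absv)
    then show "\<forall>\<^sub>F x in nhds a. dist (- x) (- a) \<le> dist x a"
      by simp
  qed
qed

instance nonarch_local_field \<subseteq> topological_semigroup_mult
proof
  fix a b :: 'a
  show "LIM x (nhds a \<times>\<^sub>F nhds b). fst x * snd x :> nhds (a * b)"
  proof (rule metric_tendsto_imp_tendsto[where a = 0 and
        f = "\<lambda>x. dist (fst x) a * dist (snd x) 0 + absv a * dist (snd x) b"])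
    show "((\<lambda>x. dist (fst x) a * dist (snd x) 0 + absv a * dist (snd x) b) \<longlongrightarrow> 0) (nhds a \<times>\<^sub>F nhds b)"
      by (rule tendsto_eq_intros tendsto_dist filterlim_fst filterlim_snd refl | simp)+
    show "\<forall>\<^sub>F x in nhds a \<times>\<^sub>F nhds b. dist (fst x * snd x) (a * b)
        \<le> dist (dist (fst x) a * dist (snd x) 0 + absv a * dist (snd x) b) 0"
    proof (intro always_eventually allI)
      fix x :: "'a \<times> 'a"
      have "dist (fst x * snd x) (a * b) = absv ((fst x - a) * snd x + a * (snd x - b))"
        by (simp add: dist_absv algebra_simps)
      also have "\<dots> \<le> max (absv ((fst x - a) * snd x)) (absv (a * (snd x - b)))"
        by (rule absv_ultrametric)
      also have "\<dots> \<le> absv (fst x - a) * absv (snd x) + absv a * absv (snd x - b)"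
        by (simp add: absv_mult)
      finally show "dist (fst x * snd x) (a * b)
          \<le> dist (dist (fst x) a * dist (snd x) 0 + absv a * dist (snd x) b) 0"
        by (simp add: dist_absv dist_real_def)
    qed
  qed
qed

text \<open>
  Local compactness gives one compact ball of positive radius about \<open>0\<close>. Multiplication by a large
  negative power of an element \<open>a\<close> with \<open>0 < absv a < 1\<close>, which exists since the field is not discrete,
  blows it up to cover any given ball.
\<close>

lemma compact_cball_local_field:
  fixes c :: "'a::nonarch_local_field"
  shows "compact (cball c r)"
proof -
  obtain U C :: "'a set" where UC: "open U" "compact C" "0 \<in> U" "U \<subseteq> C"
    using locally_compact[of 0] by auto
  then obtain e where e: "e > 0" "cball 0 e \<subseteq> U"
    by (meson open_contains_cball)
  have *: "compact (cball 0 e \<inter> C)"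
    using UC by (intro closed_Int_compact closed_cball)
  have comp_e: "compact (cball (0::'a) e)"
    using e UC * by (metis inf.orderE subset_trans)
  obtain a :: 'a where a: "a \<noteq> 0" "dist a 0 < 1"
    using perfect_choose_dist[of 1 "0::'a"] by auto
  define s where "s = absv a"
  have s: "0 < s" "s < 1"
    using a by (auto simp: s_def absv_dist_0)
  obtain n where n: "s ^ n < e / (\<bar>r\<bar> + 1)"
    using real_arch_pow_inv[of "e / (\<bar>r\<bar> + 1)" s] s e by auto
  have "compact ((\<lambda>x. c + inverse (a ^ n) * x) ` cball 0 e)"
    by (intro compact_continuous_image comp_e continuous_intros)
  moreover have "cball c r \<subseteq> (\<lambda>x. c + inverse (a ^ n) * x) ` cball 0 e"
  proof
    fix x assume "x \<in> cball c r"
    then have x: "absv (x - c) \<le> r"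
      by (simp add: dist_absv[symmetric] dist_commute)
    have "absv (a ^ n * (x - c)) = s ^ n * absv (x - c)"
      by (simp add: absv_mult absv_power s_def)
    also have "\<dots> \<le> s ^ n * (\<bar>r\<bar> + 1)"
      using x s by (intro mult_left_mono) auto
    also have "\<dots> \<le> e"
      using n by (simp add: field_simps)
    finally have "a ^ n * (x - c) \<in> cball 0 e"
      using mem_cball_0_absv by blast
    moreover have "x = c + inverse (a ^ n) * (a ^ n * (x - c))"
      using a by (simp add: field_simps)
    ultimately show "x \<in> (\<lambda>x. c + inverse (a ^ n) * x) ` cball 0 e"
      by blast
  qed
  ultimately have "compact (cball c r \<inter> (\<lambda>x. c + inverse (a ^ n) * x) ` cball 0 e)"
    by (intro closed_Int_compact closed_cball)
  with \<open>cball c r \<subseteq> _\<close> show ?thesis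
    by (simp add: Int_absorb2)
qed

text \<open>
  Each ball of integer radius about a fixed point is totally bounded; the balls of radius
  \<open>1 / Suc m\<close> about its finitely many net points, for all \<open>m\<close>, form the basis.
\<close>

lemma compact_cballs_imp_countable_basis:
  assumes "\<And>(c::'a::metric_space) r. compact (cball c r)"
  shows "\<exists>B::'a set set. countable B \<and> topological_basis B"
proof -
  define z :: 'a where "z = undefined"
  have "\<forall>(n::nat) (m::nat). \<exists>K. finite K \<and> cball z n \<subseteq> (\<Union>x\<in>K. ball x (1 / Suc m))"
    using assms[of z] unfolding compact_eq_totally_bounded by simp
  then obtain K where K: "\<And>n m. finite (K n m)"
    "\<And>(n::nat) (m::nat). cball z n \<subseteq> (\<Union>x\<in>K n m. ball x (1 / Suc m))"
    by metis
  define B where "B = (\<Union>n m. (\<lambda>x. ball x (1 / real (Suc m))) ` K n m)"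
  have "topological_basis B"
  proof (rule topological_basisI)
    fix U and x :: 'a assume "open U" "x \<in> U"
    then obtain e where e: "e > 0" "ball x e \<subseteq> U"
      by (meson open_contains_ball)
    obtain m where m: "1 / real (Suc m) < e / 2"
      using nat_approx_posE[of "e / 2"] e by auto
    obtain n :: nat where "dist z x \<le> n"
      using real_arch_simple by blast
    then obtain y where y: "y \<in> K n m" "x \<in> ball y (1 / Suc m)"
      using K(2)[of n m] by auto
    have "ball y (1 / Suc m) \<subseteq> ball x e"
    proof
      fix w assume "w \<in> ball y (1 / Suc m)"
      then have "dist x w < 1 / Suc m + 1 / Suc m"
        using y(2) dist_triangle2[of x w y] by (auto simp: dist_commute)
      then show "w \<in> ball x e"
        using m by simp
    qed
    moreover have "ball y (1 / Suc m) \<in> B"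
      using y unfolding B_def by blast
    ultimately show "\<exists>B'\<in>B. x \<in> B' \<and> B' \<subseteq> U"
      using y(2) e(2) by blast
  qed (auto simp: B_def)
  moreover have "countable B"
    unfolding B_def by (simp add: K(1) countable_finite)
  ultimately show ?thesis
    by blast
qed

instance nonarch_local_field \<subseteq> second_countable_topology
  using compact_cballs_imp_countable_basis[OF compact_cball_local_field] topological_basis_imp_subbasis
  by intro_classes blast

section \<open>Haar measure and characters on balls\<close>

lemma borel_measurable_diff_local_field [measurable (raw)]:
  fixes f g :: "'c \<Rightarrow> 'a::nonarch_local_field"
  assumes "f \<in> borel_measurable M" "g \<in> borel_measurable M"
  shows "(\<lambda>x. f x - g x) \<in> borel_measurable M"
  using assms by (rule borel_measurable_continuous_Pair) (intro continuous_intros)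

lemma borel_measurable_times_local_field [measurable (raw)]:
  fixes f g :: "'c \<Rightarrow> 'a::nonarch_local_field"
  assumes "f \<in> borel_measurable M" "g \<in> borel_measurable M"
  shows "(\<lambda>x. f x * g x) \<in> borel_measurable M"
  using assms by (rule borel_measurable_continuous_Pair) (intro continuous_intros)

lemma integral_indicator_complex:
  assumes "A \<in> sets M" "emeasure M A < \<infinity>"
  shows "(LINT x|M. (indicator A x :: complex)) = of_real (measure M A)"
proof -
  have "(indicator A x :: complex) = of_real (indicator A x)" for x
    by (simp add: indicator_def)
  then show ?thesis
    using assms sets.sets_into_space[of A M] by (simp add: Int_absorb2)
qed

locale local_field =
  fixes \<pi> :: "'a::nonarch_local_field"
    and q :: nat
    and \<mm> :: "'a measure"
    and \<psi> :: "'a \<Rightarrow> complex"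
  assumes normalized: "normalized_uniformizer \<pi>"
    and q_def: "q = card (residue_field :: 'a set set)"
    and haar: "normalized_haar \<mm>"
    and character: "additive_character \<psi>"
    and character_integers: "\<forall>x\<in>\<O>\<^sub>F. \<psi> x = 1"
    and character_nontrivial: "\<not> \<psi> constant_on ((\<lambda>x. inverse \<pi> * x) ` \<O>\<^sub>F)"
begin

lemma sets_haar [measurable_cong]: "sets \<mm> = sets borel"
  using haar by (simp add: normalized_haar_def)

lemma space_haar [simp]: "space \<mm> = UNIV"
  using sets_eq_imp_space_eq[OF sets_haar] by simp

lemma absv_uniformizer: "absv \<pi> = inverse (real q)"
  using normalized q_def by (simp add: normalized_uniformizer_def)

lemma maximal_ideal_eq: "{x. absv x < 1} = (\<lambda>x. \<pi> * x) ` {x. absv x \<le> 1}"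
  using normalized
  by (simp add: normalized_uniformizer_def uniformizer_def maximal_ideal_def ring_of_integers_def)

text \<open>
  As \<open>\<pi>\<close> lies in the maximal ideal, \<open>inverse q < 1\<close>. An infinite residue field has \<open>card\<close> \<open>0\<close>; then
  \<open>\<pi>\<close> would be \<open>0\<close> and the maximal ideal trivial, although the field is not discrete.
\<close>

lemma q_ge_2: "2 \<le> q"
proof -
  have "\<pi> = \<pi> * 1" by simp
  then have "\<pi> \<in> {x. absv x < 1}"
    unfolding maximal_ideal_eq using absv_one[where 'a = 'a] by (metis imageI mem_Collect_eq order_refl)
  then have "inverse (real q) < 1"
    by (simp add: absv_uniformizer)
  moreover have "q \<noteq> 0"
  proof
    assume "q = 0"
    then have "\<pi> = 0"
      using absv_uniformizer by simp
    then have "{x::'a. absv x < 1} \<subseteq> {0}"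
      unfolding maximal_ideal_eq by auto
    moreover obtain a :: 'a where "a \<noteq> 0" "dist a 0 < 1"
      using perfect_choose_dist[of 1 "0::'a"] by auto
    ultimately show False
      by (auto simp: absv_dist_0)
  qed
  ultimately show ?thesis
    by (cases "q = 1") auto
qed

lemma q_pos: "0 < real q" and q_gt_1: "1 < real q"
  using q_ge_2 by auto

lemma uniformizer_nonzero: "\<pi> \<noteq> 0"
  using absv_uniformizer q_pos by auto

text \<open>
  The radius is indexed by the exponent, so that \<open>disc k\<close> is the subgroup \<open>\<pi> powi (- k) * \<O>\<^sub>F\<close> and
  \<open>disc (- k)\<close> is its dual with respect to \<open>\<psi>\<close>.
\<close>

definition disc :: "int \<Rightarrow> 'a set"
  where "disc k = cball 0 (real q powi k)"

lemma mem_disc: "x \<in> disc k \<longleftrightarrow> absv x \<le> real q powi k"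
  unfolding disc_def by (rule mem_cball_0_absv)

lemma mem_disc_iff_scaled: "x \<in> disc k \<longleftrightarrow> absv (\<pi> powi k * x) \<le> 1"
proof -
  have "absv (\<pi> powi k * x) = absv x / real q powi k"
    by (simp add: absv_mult absv_power_int absv_uniformizer power_int_inverse divide_inverse_commute)
  moreover have "0 < real q powi k"
    using q_pos by simp
  ultimately show ?thesis
    by (simp add: mem_disc pos_divide_le_eq)
qed

lemma uniformizer_powi_mult: "\<pi> powi k * (\<pi> powi l * x) = \<pi> powi (k + l) * x"
  using uniformizer_nonzero by (simp add: power_int_add)

lemma uniformizer_powi_minus_one: "\<pi> powi (- 1) = inverse \<pi>"
  using power_int_minus[of \<pi> 1] by simp

lemma compact_disc: "compact (disc k)"
  unfolding disc_def by (rule compact_cball_local_field)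

lemma bounded_disc: "bounded (disc k)"
  unfolding disc_def by simp

lemma borel_disc [measurable]: "disc k \<in> sets borel"
  unfolding disc_def by simp

lemma disc_mono: "k \<le> l \<Longrightarrow> disc k \<subseteq> disc l"
  using q_gt_1 power_int_increasing[of k l "real q"] by (force simp: mem_disc)

lemma disc_add: "x \<in> disc k \<Longrightarrow> y \<in> disc k \<Longrightarrow> x + y \<in> disc k"
  unfolding mem_disc by (rule order_trans[OF absv_ultrametric]) simp

lemma disc_uminus: "- x \<in> disc k \<longleftrightarrow> x \<in> disc k"
  by (simp add: mem_disc)

lemma disc_add_iff: "y \<in> disc k \<Longrightarrow> x + y \<in> disc k \<longleftrightarrow> x \<in> disc k"
  using disc_add[of x k y] disc_add[of "x + y" k "- y"] by (auto simp: disc_uminus)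

lemma disc_diff_iff: "x \<in> disc k \<Longrightarrow> x - y \<in> disc k \<longleftrightarrow> y \<in> disc k"
  using disc_add_iff[of x k "- y"] by (simp add: add.commute disc_uminus)

lemma bounded_subset_disc:
  assumes "bounded B"
  shows "\<exists>k\<ge>0. B \<subseteq> disc k"
proof -
  obtain r where r: "\<And>x. x \<in> B \<Longrightarrow> dist 0 x \<le> r"
    using assms unfolding bounded_any_center[of B 0] by blast
  obtain n where n: "r < real q ^ n"
    using real_arch_pow[OF q_gt_1] by blast
  have "B \<subseteq> disc (int n)"
  proof
    fix x assume "x \<in> B"
    then have "dist 0 x \<le> real q ^ n"
      using r[of x] n by linarith
    then show "x \<in> disc (int n)"
      by (simp add: disc_def)
  qed
  then show ?thesis
    using of_nat_0_le_iff by blast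
qed

lemma maximal_ideal_disc: "{x::'a. absv x < 1} = disc (-1)"
proof -
  have "absv x < 1 \<longleftrightarrow> absv (inverse \<pi> * x) \<le> 1" for x
  proof -
    have "absv x < 1 \<longleftrightarrow> (\<exists>y. absv y \<le> 1 \<and> x = \<pi> * y)"
      using maximal_ideal_eq by (auto simp: set_eq_iff image_iff)
    also have "\<dots> \<longleftrightarrow> absv (inverse \<pi> * x) \<le> 1"
      using uniformizer_nonzero by (auto simp: field_simps intro!: exI[of _ "inverse \<pi> * x"])
    finally show ?thesis .
  qed
  then show ?thesis
    unfolding set_eq_iff mem_Collect_eq mem_disc_iff_scaled uniformizer_powi_minus_one by blast
qed

lemma emeasure_translate: "A \<in> sets borel \<Longrightarrow> emeasure \<mm> ((\<lambda>a. a + x) ` A) = emeasure \<mm> A"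
  using haar by (simp add: normalized_haar_def)

lemma translate_image_eq: "(\<lambda>a. a + x) ` A = {y::'a. y - x \<in> A}"
  by (auto intro!: image_eqI[of _ _ "_ - x"])

lemma borel_translate: "A \<in> sets borel \<Longrightarrow> (\<lambda>a. a + (x::'a)) ` A \<in> sets borel"
  unfolding translate_image_eq by (simp add: pred_def[symmetric])

lemma emeasure_compact: "compact C \<Longrightarrow> emeasure \<mm> C < \<infinity>"
  using haar by (simp add: normalized_haar_def)

lemma finite_residue_field: "finite (residue_field :: 'a set set)"
  using q_ge_2 q_def card.infinite by fastforce

text \<open>
  The subgroup \<open>disc k\<close> has index \<open>q\<close> in \<open>disc (k + 1)\<close>: scaling by \<open>\<pi> powi (k + 1)\<close> turns the
  quotient into the residue field. So \<open>disc (k + 1)\<close> is a disjoint union of \<open>q\<close> translates of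
  \<open>disc k\<close>, one for each representative \<open>r c\<close> of a residue class.
\<close>

lemma measure_disc_Suc: "measure \<mm> (disc (k + 1)) = real q * measure \<mm> (disc k)"
proof -
  define R where "R = {(x::'a, y). x \<in> \<O>\<^sub>F \<and> y \<in> \<O>\<^sub>F \<and> x - y \<in> \<M>\<^sub>F}"
  have mod: "\<M>\<^sub>F = disc (-1)" and int: "\<O>\<^sub>F = disc 0"
    using maximal_ideal_disc by (auto simp: maximal_ideal_def ring_of_integers_def mem_disc)
  have "equiv \<O>\<^sub>F R"
  proof (rule equivI)
    show "sym R"
      unfolding R_def mod sym_def using disc_uminus by (metis (no_types, lifting) case_prodD case_prodI mem_Collect_eq minus_diff_eq)
    show "trans R"
    proof (rule transI)
      fix x y z assume "(x, y) \<in> R" "(y, z) \<in> R"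
      then show "(x, z) \<in> R"
        using disc_add[of "x - y" "-1" "y - z"] by (simp add: R_def mod)
    qed
  qed (auto simp: R_def refl_on_def mod mem_disc)
  have res: "residue_field = \<O>\<^sub>F // R"
    by (simp add: residue_field_def R_def)
  define r where "r c = (SOME x::'a. x \<in> c)" for c
  have r: "r c \<in> c" if "c \<in> residue_field" for c
    using in_quotient_imp_non_empty[OF \<open>equiv _ _\<close>] that unfolding res r_def
    by (metis ex_in_conv someI_ex)
  have r_int: "r c \<in> \<O>\<^sub>F" if "c \<in> residue_field" for c
    using in_quotient_imp_subset[OF \<open>equiv _ _\<close>] r[OF that] that unfolding res by blast
  define t where "t c = \<pi> powi (- k - 1) * r c" for c
  have scale: "\<pi> powi (k + 1) * (\<pi> powi (- k - 1) * x) = x" for x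
    by (simp add: uniformizer_powi_mult)
  have disc_k: "y \<in> disc k \<longleftrightarrow> \<pi> powi (k + 1) * y \<in> \<M>\<^sub>F" for y
    unfolding mod mem_disc_iff_scaled uniformizer_powi_mult by simp
  have disc_k1: "y \<in> disc (k + 1) \<longleftrightarrow> \<pi> powi (k + 1) * y \<in> \<O>\<^sub>F" for y
    by (simp add: ring_of_integers_def mem_disc_iff_scaled)
  have un: "disc (k + 1) = (\<Union>c\<in>residue_field. (\<lambda>a. a + t c) ` disc k)"
  proof (intro Set.set_eqI iffI)
    fix x assume x: "x \<in> disc (k + 1)"
    define z where "z = \<pi> powi (k + 1) * x"
    have z: "z \<in> \<O>\<^sub>F"
      using x disc_k1 z_def by simp
    define c where "c = R `` {z}"
    have c: "c \<in> residue_field"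
      unfolding res c_def using z by (rule quotientI)
    then have "(z, r c) \<in> R"
      using r c_def by auto
    then have "z - r c \<in> \<M>\<^sub>F"
      by (simp add: R_def)
    then have "x - t c \<in> disc k"
      by (simp add: disc_k z_def t_def right_diff_distrib scale)
    then show "x \<in> (\<Union>c\<in>residue_field. (\<lambda>a. a + t c) ` disc k)"
      using c by (auto simp: translate_image_eq)
  next
    fix x assume "x \<in> (\<Union>c\<in>residue_field. (\<lambda>a. a + t c) ` disc k)"
    then obtain c where c: "c \<in> residue_field" "x - t c \<in> disc k"
      by (auto simp: translate_image_eq)
    then have "x - t c \<in> disc (k + 1)"
      using disc_mono[of k "k + 1"] by auto
    moreover have "t c \<in> disc (k + 1)"
      using r_int[OF c(1)] by (simp add: disc_k1 t_def scale)
    ultimately show "x \<in> disc (k + 1)"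
      using disc_add[of "x - t c" "k + 1" "t c"] by simp
  qed
  have disj: "disjoint_family_on (\<lambda>c. (\<lambda>a. a + t c) ` disc k) residue_field"
    unfolding disjoint_family_on_def
  proof (intro ballI impI, rule ccontr)
    fix c d :: "'a set" assume cd: "c \<in> residue_field" "d \<in> residue_field" "c \<noteq> d"
      and "(\<lambda>a. a + t c) ` disc k \<inter> (\<lambda>a. a + t d) ` disc k \<noteq> {}"
    then obtain x where x: "x - t c \<in> disc k" "x - t d \<in> disc k"
      unfolding translate_image_eq by blast
    then have "(x - t d) - (x - t c) \<in> disc k"
      using disc_diff_iff by blast
    then have "t c - t d \<in> disc k"
      by simp
    then have "r c - r d \<in> \<M>\<^sub>F"
      by (simp add: disc_k t_def right_diff_distrib scale)
    then have "(r c, r d) \<in> R"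
      using r_int cd by (simp add: R_def)
    then have "c = d"
      using quotient_eqI[OF \<open>equiv _ _\<close>, of c d] cd r unfolding res by blast
    with cd show False by simp
  qed
  have "measure \<mm> (disc (k + 1)) = (\<Sum>c\<in>(residue_field :: 'a set set). measure \<mm> ((\<lambda>a. a + t c) ` disc k))"
    unfolding un
  proof (rule measure_finite_Union[OF finite_residue_field _ disj])
    show "(\<lambda>c. (\<lambda>a. a + t c) ` disc k) ` residue_field \<subseteq> sets \<mm>"
      using borel_translate borel_disc by (auto simp: sets_haar)
    show "emeasure \<mm> ((\<lambda>a. a + t c) ` disc k) \<noteq> \<infinity>" for c
      using emeasure_translate emeasure_compact[OF compact_disc, of k] by simp
  qed
  also have "\<dots> = (\<Sum>c\<in>(residue_field :: 'a set set). measure \<mm> (disc k))"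
    by (simp add: measure_def emeasure_translate)
  finally show ?thesis
    by (simp add: q_def)
qed

lemma measure_disc: "measure \<mm> (disc k) = real q powi k"
proof (induction k rule: int_induct[where k = 0])
  case base
  have "disc 0 = \<O>\<^sub>F"
    by (auto simp: mem_disc ring_of_integers_def)
  then show ?case
    using haar by (simp add: normalized_haar_def measure_def)
next
  case (step1 i)
  then show ?case
    using measure_disc_Suc[of i] q_pos by (simp add: power_int_add)
next
  case (step2 i)
  have "real q * measure \<mm> (disc (i - 1)) = real q * real q powi (i - 1)"
    using step2 measure_disc_Suc[of "i - 1"] q_pos power_int_add[of "real q" 1 "i - 1"] by simp
  then show ?case
    using q_pos by simp
qed

lemma emeasure_disc: "emeasure \<mm> (disc k) < \<infinity>"
  by (rule emeasure_compact[OF compact_disc])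

sublocale sigma_finite_measure \<mm>
proof
  have "x \<in> (\<Union>n. disc (int n))" for x
  proof -
    obtain k where "k \<ge> 0" "x \<in> disc k"
      using bounded_subset_disc[of "{x}"] by auto
    then show ?thesis
      by (auto elim: nonneg_int_cases)
  qed
  then show "\<exists>A. countable A \<and> A \<subseteq> sets \<mm> \<and> \<Union> A = space \<mm> \<and> (\<forall>a\<in>A. emeasure \<mm> a \<noteq> \<infinity>)"
    using emeasure_disc
    by (intro exI[of _ "range (\<lambda>n. disc (int n))"]) (auto simp: sets_haar less_top)
qed

lemma distr_translate: "distr \<mm> borel (\<lambda>x. x + t) = \<mm>"
proof (rule measure_eqI)
  show "sets (distr \<mm> borel (\<lambda>x. x + t)) = sets \<mm>"
    by (simp add: sets_haar)
  fix A assume "A \<in> sets (distr \<mm> borel (\<lambda>x. x + t))"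
  then have A: "A \<in> sets borel" by simp
  have "(\<lambda>x. x + t) -` A = (\<lambda>a. a + (- t)) ` A"
    unfolding translate_image_eq by auto
  then show "emeasure (distr \<mm> borel (\<lambda>x. x + t)) A = emeasure \<mm> A"
    using A emeasure_translate[OF A, of "- t"] by (simp add: emeasure_distr)
qed

lemma integral_translate:
  fixes f :: "'a \<Rightarrow> 'b::{banach, second_countable_topology}"
  assumes "f \<in> borel_measurable borel"
  shows "(LINT x|\<mm>. f (x + t)) = (LINT x|\<mm>. f x)"
proof -
  have "(LINT x|\<mm>. f x) = (LINT x|distr \<mm> borel (\<lambda>x. x + t). f x)"
    by (simp add: distr_translate)
  also have "\<dots> = (LINT x|\<mm>. f (x + t))"
    using assms by (intro integral_distr) auto
  finally show ?thesis ..
qed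

lemma character_measurable [measurable]: "\<psi> \<in> borel_measurable borel"
  using character by (simp add: additive_character_def borel_measurable_continuous_onI)

lemma norm_character [simp]: "norm (\<psi> x) = 1"
  and character_add: "\<psi> (x + y) = \<psi> x * \<psi> y"
  using character by (auto simp: additive_character_def)

lemma character_0 [simp]: "\<psi> 0 = 1"
  using character_integers by (simp add: ring_of_integers_def)

text \<open>
  Orthogonality: \<open>t \<mapsto> \<psi> (t * u)\<close> is a character of the group \<open>disc m\<close>. It is trivial if
  \<open>u \<in> disc (- m)\<close>, since then \<open>t * u\<close> is an integer. Otherwise some \<open>t0 \<in> disc m\<close> has
  \<open>\<psi> (t0 * u) \<noteq> 1\<close>, and translating the integral by \<open>t0\<close> multiplies it by this value, so that
  it vanishes.
\<close>

lemma integral_character_disc: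
  "(LINT t|\<mm>. indicator (disc m) t * \<psi> (t * u))
    = (if u \<in> disc (- m) then of_real (real q powi m) else 0)"
proof (cases "u \<in> disc (- m)")
  case True
  have "indicator (disc m) t * \<psi> (t * u) = (indicator (disc m) t :: complex)" for t
  proof (cases "t \<in> disc m")
    case t: True
    have "absv t * absv u \<le> real q powi m * real q powi (- m)"
      using True t by (intro mult_mono) (auto simp: mem_disc)
    also have "\<dots> = 1"
      using q_pos by (simp add: power_int_minus)
    finally have "\<psi> (t * u) = 1"
      using character_integers by (simp add: ring_of_integers_def absv_mult)
    then show ?thesis by simp
  qed simp
  then have "(LINT t|\<mm>. indicator (disc m) t * \<psi> (t * u)) = (LINT t|\<mm>. indicator (disc m) t)"
    by (simp only:)
  also have "\<dots> = of_real (measure \<mm> (disc m))"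
    using emeasure_disc by (intro integral_indicator_complex) (auto simp: sets_haar)
  finally show ?thesis
    using True by (simp add: measure_disc)
next
  case False
  obtain z where z: "absv z \<le> 1" "\<psi> (inverse \<pi> * z) \<noteq> 1"
    using character_nontrivial unfolding constant_on_def by (auto simp: ring_of_integers_def)
  define v where "v = \<pi> powi (- m) * u"
  have "absv v > 1"
    using False by (simp add: mem_disc_iff_scaled v_def)
  then have "v \<noteq> 0" "absv (inverse v) < 1"
    by (auto simp: absv_inverse inverse_less_1_iff)
  moreover from this have "u \<noteq> 0"
    by (auto simp: v_def)
  ultimately have v: "v \<noteq> 0" "absv (inverse v) < 1" "u \<noteq> 0"
    by simp_all
  then have "inverse v \<in> disc (-1)"
    using maximal_ideal_disc by blast
  then have w: "absv (inverse \<pi> * inverse v) \<le> 1"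
    by (simp add: mem_disc_iff_scaled uniformizer_powi_minus_one)
  \<comment> \<open>chosen so that \<open>t0 * u\<close> is the point of \<open>\<pi>\<^sup>-\<^sup>1\<O>\<^sub>F\<close> at which \<open>\<psi>\<close> is nontrivial\<close>
  define t0 where "t0 = inverse \<pi> * z * inverse u"
  have "\<pi> powi m * t0 = z * (inverse \<pi> * inverse v)"
    using uniformizer_nonzero v by (simp add: t0_def v_def power_int_minus field_simps)
  then have t0: "t0 \<in> disc m"
    using w z by (simp add: mem_disc_iff_scaled absv_mult mult_le_one)
  have t0u: "t0 * u = inverse \<pi> * z"
    using v by (simp add: t0_def)
  let ?f = "\<lambda>t. indicator (disc m) t * \<psi> (t * u)"
  have "(LINT t|\<mm>. ?f t) = (LINT t|\<mm>. ?f (t + t0))"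
    by (rule integral_translate[symmetric]) measurable
  also have "\<dots> = (LINT t|\<mm>. \<psi> (t0 * u) * ?f t)"
    using disc_add_iff[OF t0]
    by (intro Bochner_Integration.integral_cong) (auto simp: indicator_def distrib_right character_add)
  also have "\<dots> = \<psi> (t0 * u) * (LINT t|\<mm>. ?f t)"
    by simp
  finally have "(\<psi> (t0 * u) - 1) * (LINT t|\<mm>. ?f t) = 0"
    by (simp add: algebra_simps)
  with z(2) False show ?thesis
    by (simp add: t0u)
qed

end

section \<open>The Fourier energy of a set on a ball\<close>

lemma integrable_bounded_by_indicator:
  fixes f :: "'c \<Rightarrow> 'b::{banach, second_countable_topology}"
  assumes "f \<in> borel_measurable M" "A \<in> sets M" "emeasure M A < \<infinity>"
    and "\<And>x. x \<in> space M \<Longrightarrow> norm (f x) \<le> indicator A x"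
  shows "integrable M f"
proof (rule Bochner_Integration.integrable_bound)
  show "integrable M (indicator A :: 'c \<Rightarrow> real)"
    using assms(2,3) by (rule integrable_real_indicator)
  show "AE x in M. norm (f x) \<le> norm (indicator A x :: real)"
    using assms(4) by (intro AE_I2) auto
qed (rule assms(1))

locale local_field_set = local_field \<pi> q \<mm> \<psi>
  for \<pi> :: "'a::nonarch_local_field" and q \<mm> \<psi> +
  fixes S :: "'a set"
  assumes borel_S [measurable]: "S \<in> sets borel"
    and finite_S: "emeasure \<mm> S < \<infinity>"
begin

definition overlap :: "'a \<Rightarrow> real"
  where "overlap y = measure \<mm> (S \<inter> (\<lambda>s. s + y) ` S)"

text \<open>
  As \<open>disc (- m)\<close> has measure \<open>q powi (- m)\<close>, this is the mean over \<open>y \<in> disc (- m)\<close> of the measure of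
  the part of \<open>S\<close> that the translate \<open>S + y\<close> misses.
\<close>

definition defect :: "int \<Rightarrow> real"
  where "defect m = real q powi m * (LINT y:disc (- m)|\<mm>. measure \<mm> (S - (\<lambda>s. s + y) ` S))"

lemma overlap_integral: "overlap y = (LINT b|\<mm>. indicator S b * indicator S (b + y))"
proof -
  have [measurable]: "(\<lambda>s. s + y) ` S \<in> sets borel"
    using borel_S by (rule borel_translate)
  have "(LINT b|\<mm>. indicator S b * indicator S (b + y) :: real)
      = (LINT b|\<mm>. indicator S ((b + y) - y) * indicator S (b + y))"
    by simp
  also have "\<dots> = (LINT b|\<mm>. indicator S (b - y) * indicator S b)"
    by (rule integral_translate) measurable
  also have "\<dots> = (LINT b|\<mm>. indicator (S \<inter> (\<lambda>s. s + y) ` S) b)"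
    unfolding translate_image_eq by (intro Bochner_Integration.integral_cong) (auto simp: indicator_def)
  also have "\<dots> = overlap y"
    by (simp add: overlap_def)
  finally show ?thesis ..
qed

lemma measure_translate_defect: "measure \<mm> (S - (\<lambda>s. s + y) ` S) = measure \<mm> S - overlap y"
proof -
  have "(\<lambda>s. s + y) ` S \<in> sets borel"
    using borel_S by (rule borel_translate)
  then have "measure \<mm> (S - S \<inter> (\<lambda>s. s + y) ` S) = measure \<mm> S - overlap y"
    unfolding overlap_def using finite_S by (intro measure_Diff) (auto simp: sets_haar less_top)
  moreover have "S - S \<inter> (\<lambda>s. s + y) ` S = S - (\<lambda>s. s + y) ` S"
    by blast
  ultimately show ?thesis
    by simp
qed

sublocale haar_pair: pair_sigma_finite \<mm> \<mm> ..

lemma integrable_overlap_kernel: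
  "integrable (\<mm> \<Otimes>\<^sub>M \<mm>) (\<lambda>(b, y). indicator S b * indicator S (b + y) * indicator (disc k) y :: real)"
proof (rule integrable_bounded_by_indicator[where A = "S \<times> disc k"])
  have "emeasure (\<mm> \<Otimes>\<^sub>M \<mm>) (S \<times> disc k) = emeasure \<mm> S * emeasure \<mm> (disc k)"
    by (intro emeasure_pair_measure_Times) (auto simp: sets_haar)
  also have "\<dots> < \<infinity>"
    using finite_S emeasure_disc by (simp add: ennreal_mult_less_top)
  finally show "emeasure (\<mm> \<Otimes>\<^sub>M \<mm>) (S \<times> disc k) < \<infinity>" .
  show "S \<times> disc k \<in> sets (\<mm> \<Otimes>\<^sub>M \<mm>)"
    by (intro pair_measureI) (auto simp: sets_haar)
  show "norm ((case x of (b, y) \<Rightarrow> indicator S b * indicator S (b + y) * indicator (disc k) y) :: real)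
      \<le> indicator (S \<times> disc k) x" for x
    by (cases x) (auto simp: indicator_def)
qed measurable

lemma integral_overlap_kernel:
  "(LINT y|\<mm>. LINT b|\<mm>. indicator S b * indicator S (b + y) * indicator (disc k) y)
    = (LINT y:disc k|\<mm>. overlap y)"
  unfolding set_lebesgue_integral_def overlap_integral by (simp add: mult.commute)

lemma set_integrable_overlap: "set_integrable \<mm> (disc k) overlap"
  using haar_pair.integrable_snd[OF integrable_overlap_kernel[of k]]
  unfolding set_integrable_def overlap_integral by (simp add: mult.commute)

lemma integral_overlap_disc:
  "real q powi m * (LINT y:disc (- m)|\<mm>. overlap y) = measure \<mm> S - defect m"
proof -
  have 1: "set_integrable \<mm> (disc (- m)) (\<lambda>y. measure \<mm> S)"
    unfolding set_integrable_def using emeasure_disc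
    by (intro integrable_scaleR_left integrable_real_indicator) (auto simp: sets_haar)
  have "(LINT y:disc (- m)|\<mm>. measure \<mm> (S - (\<lambda>s. s + y) ` S))
      = (LINT y:disc (- m)|\<mm>. measure \<mm> S) - (LINT y:disc (- m)|\<mm>. overlap y)"
    unfolding measure_translate_defect by (rule set_integral_diff(2)[OF 1 set_integrable_overlap])
  also have "(LINT y:disc (- m)|\<mm>. measure \<mm> S) = real q powi (- m) * measure \<mm> S"
    by (simp add: set_lebesgue_integral_def measure_disc)
  finally have "defect m = real q powi m * (real q powi (- m) * measure \<mm> S) -
      real q powi m * (LINT y:disc (- m)|\<mm>. overlap y)"
    by (simp add: defect_def right_diff_distrib)
  also have "real q powi m * (real q powi (- m) * measure \<mm> S) = measure \<mm> S"
    using q_pos by (simp add: power_int_minus)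
  finally show ?thesis
    by simp
qed

text \<open>
  This is \<open>\<bar>F t\<bar>\<^sup>2\<close> for the Fourier transform \<open>F\<close> of the indicator of \<open>S\<close>, as \<open>F (- t)\<close> is the
  conjugate of \<open>F t\<close>. The product form is the one that appears in the determinant.
\<close>

definition energy :: "'a \<Rightarrow> complex"
  where "energy t = fourier \<mm> \<psi> (indicator S) t * fourier \<mm> \<psi> (indicator S) (- t)"

lemma fourier_measurable [measurable]: "fourier \<mm> \<psi> (indicator S) \<in> borel_measurable borel"
proof -
  have "(\<lambda>y. LINT x|\<mm>. indicator S x * \<psi> (x * y)) \<in> borel_measurable borel"
    by measurable
  then show ?thesis
    by (simp add: fourier_def[abs_def])
qed

lemma energy_measurable [measurable]: "energy \<in> borel_measurable borel"
proof -
  have "(\<lambda>t. fourier \<mm> \<psi> (indicator S) t * fourier \<mm> \<psi> (indicator S) (0 - t)) \<in> borel_measurable borel"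
    by measurable
  then show ?thesis
    by (simp add: energy_def[abs_def])
qed

lemma energy_uminus: "energy (- t) = energy t"
  by (simp add: energy_def)

lemma fourier_0: "fourier \<mm> \<psi> (indicator S) 0 = of_real (measure \<mm> S)"
  unfolding fourier_def using finite_S
  by (simp add: sets_haar integral_indicator_complex)

text \<open>
  Writing both Fourier transforms as integrals over \<open>S\<close> and integrating over \<open>t\<close> first leaves, by
  orthogonality, \<open>q powi m\<close> times the measure of the pairs \<open>(a, b)\<close> in \<open>S \<times> S\<close> with
  \<open>a - b \<in> disc (- m)\<close>. The substitution \<open>a = b + y\<close> turns this into an integral of the overlap of
  \<open>S\<close> with its translates. Everything is absolutely integrable because \<open>S\<close> and the ball have finite
  measure.
\<close>

lemma integral_energy_disc:
  "(LINT t|\<mm>. indicator (disc m) t * energy t) = of_real (measure \<mm> S - defect m)"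
proof -
  define G :: "'a \<Rightarrow> 'a \<times> 'a \<Rightarrow> complex" where
    "G t p = indicator (disc m) t * ((indicator S (fst p) * \<psi> (fst p * t)) * (indicator S (snd p) * \<psi> (snd p * (0 - t))))"
    for t p
  have pair: "sigma_finite_measure (\<mm> \<Otimes>\<^sub>M \<mm>)"
    by (rule sigma_finite_pair_measure) unfold_locales
  interpret triple: pair_sigma_finite \<mm> "\<mm> \<Otimes>\<^sub>M \<mm>" ..
  have SS: "S \<times> S \<in> sets (\<mm> \<Otimes>\<^sub>M \<mm>)"
    by (intro pair_measureI) (auto simp: sets_haar)
  have eSS: "emeasure (\<mm> \<Otimes>\<^sub>M \<mm>) (S \<times> S) < \<infinity>"
    using finite_S by (subst emeasure_pair_measure_Times) (auto simp: sets_haar ennreal_mult_less_top)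
  have G [measurable]: "(\<lambda>(t, p). G t p) \<in> borel_measurable (\<mm> \<Otimes>\<^sub>M (\<mm> \<Otimes>\<^sub>M \<mm>))"
    unfolding G_def by measurable
  have intG: "integrable (\<mm> \<Otimes>\<^sub>M \<mm>) (G t)" for t
  proof (rule integrable_bounded_by_indicator[OF _ SS eSS])
    show "G t \<in> borel_measurable (\<mm> \<Otimes>\<^sub>M \<mm>)"
      unfolding G_def by measurable
    show "norm (G t p) \<le> indicator (S \<times> S) p" for p
      by (cases p) (auto simp: G_def norm_mult indicator_def)
  qed
  have intG3: "integrable (\<mm> \<Otimes>\<^sub>M (\<mm> \<Otimes>\<^sub>M \<mm>)) (\<lambda>(t, p). G t p)"
  proof (rule integrable_bounded_by_indicator[where A = "disc m \<times> (S \<times> S)", OF G])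
    show "disc m \<times> (S \<times> S) \<in> sets (\<mm> \<Otimes>\<^sub>M (\<mm> \<Otimes>\<^sub>M \<mm>))"
      using SS by (intro pair_measureI) (auto simp: sets_haar)
    have "emeasure (\<mm> \<Otimes>\<^sub>M (\<mm> \<Otimes>\<^sub>M \<mm>)) (disc m \<times> (S \<times> S))
        = emeasure \<mm> (disc m) * emeasure (\<mm> \<Otimes>\<^sub>M \<mm>) (S \<times> S)"
      using SS by (intro sigma_finite_measure.emeasure_pair_measure_Times[OF pair]) (auto simp: sets_haar)
    then show "emeasure (\<mm> \<Otimes>\<^sub>M (\<mm> \<Otimes>\<^sub>M \<mm>)) (disc m \<times> (S \<times> S)) < \<infinity>"
      using eSS emeasure_disc by (simp add: ennreal_mult_less_top)
    show "norm ((case x of (t, p) \<Rightarrow> G t p) :: complex) \<le> indicator (disc m \<times> (S \<times> S)) x" for x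
      by (cases x) (auto simp: G_def norm_mult indicator_def)
  qed
  have "(LINT t|\<mm>. indicator (disc m) t * energy t) = (LINT t|\<mm>. LINT p|(\<mm> \<Otimes>\<^sub>M \<mm>). G t p)"
  proof (intro Bochner_Integration.integral_cong refl)
    fix t
    have "(LINT p|(\<mm> \<Otimes>\<^sub>M \<mm>). G t p) = (LINT a|\<mm>. LINT b|\<mm>. G t (a, b))"
      by (rule haar_pair.integral_fst'[OF intG, symmetric])
    also have "\<dots> = indicator (disc m) t * energy t"
      by (simp add: G_def energy_def fourier_def)
    finally show "indicator (disc m) t * energy t = (LINT p|(\<mm> \<Otimes>\<^sub>M \<mm>). G t p)" ..
  qed
  also have "\<dots> = (LINT p|(\<mm> \<Otimes>\<^sub>M \<mm>). LINT t|\<mm>. G t p)"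
    by (rule triple.Fubini_integral[OF intG3, symmetric])
  also have "\<dots> = (LINT p|(\<mm> \<Otimes>\<^sub>M \<mm>). of_real (real q powi m *
      (indicator S (snd p) * indicator S (fst p) * indicator (disc (- m)) (fst p - snd p))))"
  proof (intro Bochner_Integration.integral_cong refl)
    fix p :: "'a \<times> 'a"
    have "G t p = (indicator S (fst p) * indicator S (snd p)) *
        (indicator (disc m) t * \<psi> (t * (fst p - snd p)))" for t
    proof -
      have "\<psi> (fst p * t) * \<psi> (snd p * (0 - t)) = \<psi> (t * (fst p - snd p))"
        by (simp add: character_add[symmetric] algebra_simps)
      then show ?thesis
        by (simp add: G_def)
    qed
    then show "(LINT t|\<mm>. G t p) = of_real (real q powi m *
        (indicator S (snd p) * indicator S (fst p) * indicator (disc (- m)) (fst p - snd p)))"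
      by (simp add: integral_character_disc) (auto simp: indicator_def)
  qed
  also have "\<dots> = of_real (real q powi m * (LINT p|(\<mm> \<Otimes>\<^sub>M \<mm>).
      (indicator S (snd p) * indicator S (fst p) * indicator (disc (- m)) (fst p - snd p))))"
    by (simp only: integral_complex_of_real integral_mult_right_zero)
  also have "(LINT p|(\<mm> \<Otimes>\<^sub>M \<mm>). (indicator S (snd p) * indicator S (fst p) * indicator (disc (- m)) (fst p - snd p)))
      = (LINT b|\<mm>. LINT a|\<mm>. indicator S b * indicator S a * indicator (disc (- m)) (a - b) :: real)"
  proof (subst haar_pair.integral_snd)
    show "integrable (\<mm> \<Otimes>\<^sub>M \<mm>) (\<lambda>(a, b). indicator S b * indicator S a * indicator (disc (- m)) (a - b) :: real)"
    proof (rule integrable_bounded_by_indicator[OF _ SS eSS])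
      show "norm ((case p of (a, b) \<Rightarrow> indicator S b * indicator S a * indicator (disc (- m)) (a - b)) :: real)
          \<le> indicator (S \<times> S) p" for p
        by (cases p) (auto simp: indicator_def)
    qed measurable
  qed (simp add: case_prod_unfold)
  also have "\<dots> = (LINT b|\<mm>. LINT y|\<mm>. indicator S b * indicator S (b + y) * indicator (disc (- m)) y)"
  proof (rule Bochner_Integration.integral_cong[OF refl])
    fix b
    have "(LINT a|\<mm>. indicator S b * indicator S a * indicator (disc (- m)) (a - b) :: real)
        = (LINT y|\<mm>. indicator S b * indicator S (y + b) * indicator (disc (- m)) ((y + b) - b))"
      by (rule integral_translate[symmetric]) measurable
    then show "(LINT a|\<mm>. indicator S b * indicator S a * indicator (disc (- m)) (a - b) :: real)
        = (LINT y|\<mm>. indicator S b * indicator S (b + y) * indicator (disc (- m)) y)"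
      by (simp add: add.commute)
  qed
  also have "\<dots> = (LINT y|\<mm>. LINT b|\<mm>. indicator S b * indicator S (b + y) * indicator (disc (- m)) y)"
    by (rule haar_pair.Fubini_integral[OF integrable_overlap_kernel, symmetric])
  also have "\<dots> = (LINT y:disc (- m)|\<mm>. overlap y)"
    by (rule integral_overlap_kernel)
  also have "real q powi m * \<dots> = measure \<mm> S - defect m"
    by (rule integral_overlap_disc)
  finally show ?thesis .
qed

end

section \<open>Moments of the number of points in a ball\<close>

text \<open>
  The product of the compact sets is compact by Tychonoff, hence closed as the product topology is
  Hausdorff, so it contains the closure of the support.
\<close>

lemma compactly_supportedI:
  fixes \<phi> :: "(nat \<Rightarrow> 'a::metric_space) \<Rightarrow> complex"
  assumes "\<And>i. i < n \<Longrightarrow> compact (C i)"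
    and "\<And>x i. x \<in> {..<n} \<rightarrow>\<^sub>E UNIV \<Longrightarrow> \<phi> x \<noteq> 0 \<Longrightarrow> i < n \<Longrightarrow> x i \<in> C i"
  shows "compactly_supported n \<phi>"
proof -
  define T where "T = product_topology (\<lambda>_. euclidean :: 'a topology) {..<n}"
  have comp: "compactin T (PiE {..<n} C)"
    unfolding T_def compactin_PiE using assms(1) by auto
  have "Hausdorff_space T"
    unfolding T_def Hausdorff_space_product_topology by simp
  then have clo: "closedin T (PiE {..<n} C)"
    using comp by (rule compactin_imp_closedin)
  have "{x \<in> topspace T. \<phi> x \<noteq> 0} \<subseteq> PiE {..<n} C"
  proof
    fix x assume "x \<in> {x \<in> topspace T. \<phi> x \<noteq> 0}"
    then have x: "x \<in> {..<n} \<rightarrow>\<^sub>E UNIV" "\<phi> x \<noteq> 0"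
      by (auto simp: T_def)
    then show "x \<in> PiE {..<n} C"
      using assms(2)[OF x] unfolding PiE_iff by simp
  qed
  then have "compactin T (T closure_of {x \<in> topspace T. \<phi> x \<noteq> 0})"
    using closed_compactin[OF comp closure_of_minimal[OF _ clo] closedin_closure_of] by blast
  then show ?thesis
    by (simp add: compactly_supported_def T_def)
qed

lemma det_mat_1: "Determinant.det (Matrix.mat 1 1 f) = (f (0, 0) :: complex)"
  by (subst det_single) auto

lemma det_mat_2:
  "Determinant.det (Matrix.mat 2 2 f) = (f (0, 0) * f (1, 1) - f (0, 1) * f (1, 0) :: complex)"
proof -
  have *: "{..<2::nat} = {0, 1}" by auto
  have "Determinant.det (mat_delete (Matrix.mat 2 2 f) i 0) = f (1 - i, 1)" if "i < 2" for i :: nat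
    using that by (subst det_single) (auto simp: mat_delete_def less_2_cases_iff)
  then show ?thesis
    by (subst laplace_expansion_column[where n = 2 and j = 0]) (auto simp: * cofactor_def)
qed

lemma infsum_indicator_eq_card:
  assumes "finite (D \<inter> E)"
  shows "(\<Sum>\<^sub>\<infinity>x\<in>D. indicator E x :: complex) = of_nat (card (D \<inter> E))"
proof -
  have "(\<Sum>\<^sub>\<infinity>x\<in>D. indicator E x :: complex) = (\<Sum>\<^sub>\<infinity>x\<in>D \<inter> E. 1)"
    by (rule infsum_cong_neutral) auto
  then show ?thesis
    using assms by simp
qed

lemma card_distinct_singles: "card {x \<in> distinct_tuples 1 A. x 0 \<in> C} = card (A \<inter> C)"
proof -
  have *: "{..<1::nat} = {0}" by auto
  have "{x \<in> distinct_tuples 1 A. x 0 \<in> C} = {0} \<rightarrow>\<^sub>E (A \<inter> C)"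
  proof (rule Set.set_eqI)
    fix x
    show "x \<in> {x \<in> distinct_tuples 1 A. x 0 \<in> C} \<longleftrightarrow> x \<in> {0} \<rightarrow>\<^sub>E (A \<inter> C)"
      unfolding distinct_tuples_def * mem_Collect_eq PiE_iff inj_on_def by blast
  qed
  then show ?thesis
    by (simp add: card_PiE)
qed

lemma mem_distinct_pairs_iff:
  "x \<in> distinct_tuples 2 A \<longleftrightarrow> x 0 \<in> A \<and> x 1 \<in> A \<and> x 0 \<noteq> x 1 \<and> (\<forall>i. i \<noteq> 0 \<longrightarrow> i \<noteq> 1 \<longrightarrow> x i = undefined)"
proof -
  have *: "{..<2::nat} = {0, 1}" by auto
  show ?thesis
    unfolding distinct_tuples_def * by (simp add: PiE_iff extensional_def) blast
qed

lemma distinct_pairs_bij: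
  "bij_betw (\<lambda>x. (x 0, x 1)) {x \<in> distinct_tuples 2 A. x 0 \<in> C \<and> x 1 \<in> D}
    (SIGMA a : A \<inter> C. A \<inter> D - {a})"
proof -
  define g where "g = (\<lambda>(a, b) i. if i = (0::nat) then a else if i = 1 then b else (undefined :: 'a))"
  have g: "g (a, b) 0 = a" "g (a, b) 1 = b" "i \<noteq> 0 \<Longrightarrow> i \<noteq> 1 \<Longrightarrow> g (a, b) i = undefined" for a b i
    by (simp_all add: g_def)
  have "g (x 0, x 1) = x" if "x \<in> distinct_tuples 2 A" for x
  proof
    fix i
    show "g (x 0, x 1) i = x i"
      using that unfolding mem_distinct_pairs_iff by (cases "i = 0"; cases "i = 1") (simp_all add: g del: One_nat_def)
  qed
  then show ?thesis
    by (intro bij_betw_byWitness[where f' = g])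
      (auto simp: mem_distinct_pairs_iff g simp del: One_nat_def)
qed

lemma card_distinct_pairs:
  assumes "finite (A \<inter> D)" "C \<subseteq> D"
  shows "finite {x \<in> distinct_tuples 2 A. x 0 \<in> C \<and> x 1 \<in> D}"
    and "real (card {x \<in> distinct_tuples 2 A. x 0 \<in> C \<and> x 1 \<in> D})
      = real (card (A \<inter> C)) * real (card (A \<inter> D)) - real (card (A \<inter> C))"
proof -
  have fin: "finite (A \<inter> C)"
    using assms by (meson Int_mono finite_subset order_refl)
  then have "finite (SIGMA a : A \<inter> C. A \<inter> D - {a})"
    using assms(1) by auto
  then show "finite {x \<in> distinct_tuples 2 A. x 0 \<in> C \<and> x 1 \<in> D}"
    using bij_betw_finite[OF distinct_pairs_bij] by blast
  have "card {x \<in> distinct_tuples 2 A. x 0 \<in> C \<and> x 1 \<in> D} = card (SIGMA a : A \<inter> C. A \<inter> D - {a})"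
    by (rule bij_betw_same_card[OF distinct_pairs_bij])
  also have "\<dots> = (\<Sum>a\<in>A \<inter> C. card (A \<inter> D - {a}))"
    using fin assms(1) by (intro card_SigmaI) auto
  finally have "real (card {x \<in> distinct_tuples 2 A. x 0 \<in> C \<and> x 1 \<in> D})
      = (\<Sum>a\<in>A \<inter> C. real (card (A \<inter> D - {a})))"
    by simp
  also have "\<dots> = (\<Sum>a\<in>A \<inter> C. real (card (A \<inter> D)) - 1)"
  proof (rule sum.cong[OF refl])
    fix a assume "a \<in> A \<inter> C"
    then have "a \<in> A \<inter> D"
      using assms(2) by blast
    then have "card (A \<inter> D) = Suc (card (A \<inter> D - {a}))"
      using assms(1) by (metis card.remove)
    then show "real (card (A \<inter> D - {a})) = real (card (A \<inter> D)) - 1"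
      by simp
  qed
  finally show "real (card {x \<in> distinct_tuples 2 A. x 0 \<in> C \<and> x 1 \<in> D})
      = real (card (A \<inter> C)) * real (card (A \<inter> D)) - real (card (A \<inter> C))"
    by (simp add: algebra_simps)
qed

lemma distinct_tuples_in_box:
  "distinct_tuples n A \<inter> PiE {..<n} C = {x \<in> distinct_tuples n A. \<forall>i<n. x i \<in> C i}"
proof (rule Set.set_eqI)
  fix x
  show "x \<in> distinct_tuples n A \<inter> PiE {..<n} C \<longleftrightarrow> x \<in> {x \<in> distinct_tuples n A. \<forall>i<n. x i \<in> C i}"
    unfolding distinct_tuples_def Int_iff mem_Collect_eq PiE_iff by blast
qed

lemma finite_distinct_tuples_in_box:
  assumes "\<And>i. i < n \<Longrightarrow> finite (A \<inter> C i)"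
  shows "finite (distinct_tuples n A \<inter> PiE {..<n} C)"
proof (rule finite_subset)
  show "distinct_tuples n A \<inter> PiE {..<n} C \<subseteq> (\<Pi>\<^sub>E i\<in>{..<n}. A \<inter> C i)"
    unfolding distinct_tuples_def by (simp add: subset_iff PiE_iff)
  show "finite (\<Pi>\<^sub>E i\<in>{..<n}. A \<inter> C i)"
    using assms by (intro finite_PiE) auto
qed

lemma space_config_space: "space (config_space :: 'a::metric_space set measure) = {A. locally_finite_set A}"
  by (simp add: config_space_def space_measure_of_conv)

locale set_process = local_field_set \<pi> q \<mm> \<psi> S
  for \<pi> :: "'a::nonarch_local_field" and q \<mm> \<psi> S +
  fixes P :: "'w measure" and X :: "'w \<Rightarrow> 'a set"
  assumes determinantal: "determinantal P X \<mm> (kernel_of_set \<mm> \<psi> S)"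
begin

sublocale prob_space P
  using determinantal by (simp add: determinantal_def point_process_def)

lemma measurable_process: "X \<in> measurable P config_space"
  using determinantal by (simp add: determinantal_def point_process_def)

lemma locally_finite_process: "\<omega> \<in> space P \<Longrightarrow> locally_finite_set (X \<omega>)"
  using measurable_space[OF measurable_process] by (simp add: space_config_space)

lemma finite_process_disc: "\<omega> \<in> space P \<Longrightarrow> finite (X \<omega> \<inter> disc k)"
  using locally_finite_process bounded_disc by (simp add: locally_finite_set_def)

definition count :: "int \<Rightarrow> 'w \<Rightarrow> real"
  where "count k \<omega> = real (card (X \<omega> \<inter> disc k))"

lemma kernel_diagonal: "kernel_of_set \<mm> \<psi> S x x = of_real (measure \<mm> S)"
  by (simp add: kernel_of_set_def fourier_0)

lemma kernel_energy: "kernel_of_set \<mm> \<psi> S x y * kernel_of_set \<mm> \<psi> S y x = energy (x - y)"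
  by (simp add: kernel_of_set_def energy_def)

definition correlation :: "nat \<Rightarrow> (nat \<Rightarrow> 'a) \<Rightarrow> complex"
  where "correlation n y = Determinant.det (Matrix.mat n n (\<lambda>(i, j). kernel_of_set \<mm> \<psi> S (y i) (y j)))"

sublocale product: product_sigma_finite "\<lambda>_::nat. \<mm>" ..

text \<open>
  The defining identity of the process for the indicator of a product of balls. It is compactly
  supported because closed balls are compact, and the sum over tuples is a finite count because the
  process is locally finite.
\<close>

lemma correlation_integral:
  fixes k :: "nat \<Rightarrow> int"
  assumes "n > 0"
  defines "E \<equiv> \<Pi>\<^sub>E i\<in>{..<n}. disc (k i)"
  shows "integrable (Pi\<^sub>M {..<n} (\<lambda>_. \<mm>)) (\<lambda>y. indicator E y * correlation n y)"
    and "integrable P (\<lambda>\<omega>. real (card (distinct_tuples n (X \<omega>) \<inter> E)))"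
    and "of_real (LINT \<omega>|P. real (card (distinct_tuples n (X \<omega>) \<inter> E)))
      = (LINT y|(Pi\<^sub>M {..<n} (\<lambda>_. \<mm>)). indicator E y * correlation n y)"
proof -
  let ?f = "\<lambda>y. indicator E y * correlation n y"
  let ?\<phi> = "indicator E :: (nat \<Rightarrow> 'a) \<Rightarrow> complex"
  have "E \<in> sets (Pi\<^sub>M {..<n} (\<lambda>_. \<mm>))"
    unfolding E_def by (intro sets_PiM_I_finite) (auto simp: sets_haar)
  then have "?\<phi> \<in> borel_measurable (Pi\<^sub>M {..<n} (\<lambda>_. \<mm>))"
    by measurable
  moreover have "bounded (?\<phi> ` ({..<n} \<rightarrow>\<^sub>E UNIV))"
  proof (rule boundedI[where B = 1])
    fix z assume "z \<in> ?\<phi> ` ({..<n} \<rightarrow>\<^sub>E UNIV)"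
    then obtain x where "z = ?\<phi> x"
      by blast
    then show "norm z \<le> 1"
      by (simp add: indicator_def)
  qed
  moreover have "compactly_supported n ?\<phi>"
  proof (rule compactly_supportedI[where C = "\<lambda>i. disc (k i)"])
    fix x i assume x: "?\<phi> x \<noteq> 0" "i < n"
    then have "x \<in> E"
      by (meson indicator_simps(2))
    then show "x i \<in> disc (k i)"
      using x(2) by (simp add: E_def PiE_iff)
  qed (rule compact_disc)
  ultimately have int: "integrable (Pi\<^sub>M {..<n} (\<lambda>_. \<mm>)) ?f"
    and has: "has_bochner_integral P (\<lambda>\<omega>. \<Sum>\<^sub>\<infinity>x\<in>distinct_tuples n (X \<omega>). ?\<phi> x)
      (LINT y|(Pi\<^sub>M {..<n} (\<lambda>_. \<mm>)). ?f y)"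
    using determinantal assms(1) unfolding determinantal_def correlation_def by auto
  show "integrable (Pi\<^sub>M {..<n} (\<lambda>_. \<mm>)) ?f"
    by (rule int)
  have "finite (distinct_tuples n (X \<omega>) \<inter> E)" if "\<omega> \<in> space P" for \<omega>
    unfolding E_def using finite_process_disc[OF that] by (rule finite_distinct_tuples_in_box)
  then have "has_bochner_integral P (\<lambda>\<omega>. complex_of_real (real (card (distinct_tuples n (X \<omega>) \<inter> E))))
      (LINT y|(Pi\<^sub>M {..<n} (\<lambda>_. \<mm>)). ?f y)"
    using has by (subst has_bochner_integral_cong[OF refl _ refl]) (simp_all add: infsum_indicator_eq_card)
  then show "integrable P (\<lambda>\<omega>. real (card (distinct_tuples n (X \<omega>) \<inter> E)))"
    and "of_real (LINT \<omega>|P. real (card (distinct_tuples n (X \<omega>) \<inter> E)))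
      = (LINT y|(Pi\<^sub>M {..<n} (\<lambda>_. \<mm>)). ?f y)"
    by (simp_all only: has_bochner_integral_iff complex_of_real_integrable_eq integral_complex_of_real)
qed

lemma count_first_moment:
  shows integrable_count: "integrable P (count k)"
    and expectation_count: "expectation (count k) = real q powi k * measure \<mm> S"
proof -
  have one_pos: "(0::nat) < 1" and one: "{..<1::nat} = {0}"
    by auto
  define E where "E = (\<Pi>\<^sub>E i\<in>{..<1::nat}. disc k)"
  have "distinct_tuples 1 A \<inter> E = {x \<in> distinct_tuples 1 A. x 0 \<in> disc k}" for A
    unfolding E_def distinct_tuples_in_box by simp
  then have count: "real (card (distinct_tuples 1 (X \<omega>) \<inter> E)) = count k \<omega>" for \<omega>
    by (simp only: card_distinct_singles count_def)
  note cor = correlation_integral[where n = 1 and k = "\<lambda>_. k", OF one_pos, folded E_def, unfolded count]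
  show "integrable P (count k)"
    using cor(2) by simp
  have "complex_of_real (expectation (count k)) = (LINT y|(Pi\<^sub>M {..<1} (\<lambda>_. \<mm>)). indicator E y * correlation 1 y)"
    using cor(3) by simp
  also have "\<dots> = (LINT y|(Pi\<^sub>M {0::nat} (\<lambda>_. \<mm>)). indicator (disc k) (y 0) * of_real (measure \<mm> S))"
    unfolding correlation_def det_mat_1 one
  proof (rule Bochner_Integration.integral_cong[OF refl])
    fix y :: "nat \<Rightarrow> 'a" assume "y \<in> space (Pi\<^sub>M {0::nat} (\<lambda>_. \<mm>))"
    then have "y \<in> E \<longleftrightarrow> y 0 \<in> disc k"
      unfolding E_def one by (simp add: space_PiM PiE_iff)
    then show "indicator E y * (case (0, 0) of (i, j) \<Rightarrow> kernel_of_set \<mm> \<psi> S (y i) (y j))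
        = indicator (disc k) (y 0) * complex_of_real (measure \<mm> S)"
      by (simp add: kernel_diagonal indicator_def)
  qed
  also have "\<dots> = (LINT x|\<mm>. indicator (disc k) x * of_real (measure \<mm> S))"
    by (rule product.product_integral_singleton) measurable
  also have "\<dots> = of_real (real q powi k * measure \<mm> S)"
    using emeasure_disc by (simp add: integral_indicator_complex sets_haar measure_disc)
  finally show "expectation (count k) = real q powi k * measure \<mm> S"
    using of_real_eq_iff by blast
qed

text \<open>
  Since \<open>x\<close> lies in the group \<open>disc m\<close>, the translation \<open>y \<mapsto> y + x\<close> preserves \<open>disc m\<close>, so the
  inner integral of the energy is the same for all \<open>x \<in> disc n\<close>. On an Archimedean field there
  would be a boundary term here.
\<close>

lemma integral_pair_energy:
  assumes "n \<le> m"
  shows "(LINT x|\<mm>. LINT y|\<mm>. indicator (disc n) x * (indicator (disc m) y *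
      (of_real (measure \<mm> S) * of_real (measure \<mm> S) - energy (x - y))))
    = of_real (real q powi n * (real q powi m * (measure \<mm> S)\<^sup>2 - (measure \<mm> S - defect m)))"
proof -
  have int_energy: "integrable \<mm> (\<lambda>y. indicator (disc m) y * energy (x - y))" for x
  proof -
    define c where "c = measure \<mm> S"
    have "norm (fourier \<mm> \<psi> (indicator S) t) \<le> c" for t
    proof -
      have "norm (fourier \<mm> \<psi> (indicator S) t) \<le> (LINT x|\<mm>. norm (indicator S x * \<psi> (x * t)))"
        unfolding fourier_def by (rule integral_norm_bound)
      also have "\<dots> = c"
      proof -
        have "norm (indicator S x * \<psi> (x * t)) = indicator S x" for x
          by (simp add: norm_mult indicator_def)
        then show ?thesis
          by (simp add: c_def)
      qed
      finally show ?thesis .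
    qed
    then have bound: "norm (energy t) \<le> c * c" for t
      unfolding energy_def norm_mult by (intro mult_mono) (auto simp: c_def)
    have "integrable \<mm> (\<lambda>y. indicator (disc m) y * (c * c))"
      using emeasure_disc by (intro integrable_mult_left integrable_real_indicator) (auto simp: sets_haar)
    then show ?thesis
      by (rule Bochner_Integration.integrable_bound)
        (use bound in \<open>auto intro!: AE_I2 simp: norm_mult indicator_def c_def\<close>)
  qed
  have int_disc: "integrable \<mm> (\<lambda>y. indicator (disc m) y * (of_real (measure \<mm> S) * of_real (measure \<mm> S)) :: complex)"
    using emeasure_disc
    by (intro integrable_mult_left integrable_bounded_by_indicator[where A = "disc m"])
      (auto simp: sets_haar indicator_def)
  have inner: "(LINT y|\<mm>. indicator (disc n) x * (indicator (disc m) y *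
      (of_real (measure \<mm> S) * of_real (measure \<mm> S) - energy (x - y))))
    = indicator (disc n) x * of_real (real q powi m * (measure \<mm> S)\<^sup>2 - (measure \<mm> S - defect m))" for x
  proof (cases "x \<in> disc n")
    case True
    then have x: "x \<in> disc m"
      using disc_mono[OF assms] by blast
    have "(LINT y|\<mm>. indicator (disc m) y * energy (x - y))
        = (LINT y|\<mm>. indicator (disc m) (y + x) * energy (x - (y + x)))"
      by (rule integral_translate[symmetric]) measurable
    also have "\<dots> = (LINT y|\<mm>. indicator (disc m) y * energy y)"
      using disc_add_iff[OF x] by (simp add: energy_uminus indicator_def)
    also have "\<dots> = of_real (measure \<mm> S - defect m)"
      by (rule integral_energy_disc)
    finally have "(LINT y|\<mm>. indicator (disc m) y * energy (x - y)) = of_real (measure \<mm> S - defect m)" .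
    then have "(LINT y|\<mm>. indicator (disc m) y *
        (of_real (measure \<mm> S) * of_real (measure \<mm> S) - energy (x - y)))
      = of_real (real q powi m) * (of_real (measure \<mm> S) * of_real (measure \<mm> S)) - of_real (measure \<mm> S - defect m)"
      using int_energy int_disc emeasure_disc
      by (simp add: right_diff_distrib integral_indicator_complex sets_haar measure_disc)
    then show ?thesis
      using True by (simp add: power2_eq_square)
  qed simp
  show ?thesis
    unfolding inner using emeasure_disc
    by (simp add: integral_indicator_complex sets_haar measure_disc)
qed

text \<open>
  As \<open>disc n \<subseteq> disc m\<close>, the ordered pairs of distinct points with the first in \<open>disc n\<close> and the
  second in \<open>disc m\<close> number \<open>count n * count m - count n\<close>; the subtracted term is the diagonal.
\<close>

lemma count_second_moment:
  assumes "n \<le> m"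
  shows integrable_count_mult: "integrable P (\<lambda>\<omega>. count n \<omega> * count m \<omega>)"
    and expectation_count_mult: "expectation (\<lambda>\<omega>. count n \<omega> * count m \<omega>)
      = real q powi n * real q powi m * (measure \<mm> S)\<^sup>2 + real q powi n * defect m"
proof -
  define E where "E = (\<Pi>\<^sub>E i\<in>{..<2::nat}. disc (if i = 0 then n else m))"
  have two: "{..<2::nat} = insert 1 {0}"
    by auto
  have inter: "distinct_tuples 2 A \<inter> E = {x \<in> distinct_tuples 2 A. x 0 \<in> disc n \<and> x 1 \<in> disc m}" for A
    unfolding E_def distinct_tuples_in_box by (auto simp: less_2_cases_iff)
  have count: "real (card (distinct_tuples 2 (X \<omega>) \<inter> E)) = count n \<omega> * count m \<omega> - count n \<omega>"
    if "\<omega> \<in> space P" for \<omega>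
    unfolding inter count_def using finite_process_disc[OF that] disc_mono[OF assms] by (rule card_distinct_pairs(2))
  note cor = correlation_integral[where n = 2 and k = "\<lambda>i. if i = 0 then n else m", OF zero_less_numeral, folded E_def]
  have int2: "integrable P (\<lambda>\<omega>. count n \<omega> * count m \<omega> - count n \<omega>)"
    using cor(2) by (simp add: count cong: Bochner_Integration.integrable_cong)
  then have "integrable P (\<lambda>\<omega>. (count n \<omega> * count m \<omega> - count n \<omega>) + count n \<omega>)"
    using integrable_count by (rule Bochner_Integration.integrable_add)
  then show int: "integrable P (\<lambda>\<omega>. count n \<omega> * count m \<omega>)"
    by simp
  let ?f = "\<lambda>y. indicator E y * correlation 2 y"
  have "complex_of_real (expectation (\<lambda>\<omega>. count n \<omega> * count m \<omega> - count n \<omega>)) =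
      (LINT y|(Pi\<^sub>M {..<2} (\<lambda>_. \<mm>)). ?f y)"
    using cor(3) by (simp add: count cong: Bochner_Integration.integral_cong)
  also have "\<dots> = (LINT x|(Pi\<^sub>M {0::nat} (\<lambda>_. \<mm>)). LINT y|\<mm>. ?f (x(1 := y)))"
    using cor(1) unfolding two by (intro product.product_integral_insert) auto
  also have "\<dots> = (LINT x|(Pi\<^sub>M {0::nat} (\<lambda>_. \<mm>)). LINT y|\<mm>. indicator (disc n) (x 0) * (indicator (disc m) y *
      (of_real (measure \<mm> S) * of_real (measure \<mm> S) - energy (x 0 - y))))"
  proof (rule Bochner_Integration.integral_cong[OF refl], rule Bochner_Integration.integral_cong[OF refl])
    fix x :: "nat \<Rightarrow> 'a" and y
    assume "x \<in> space (Pi\<^sub>M {0::nat} (\<lambda>_. \<mm>))"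
    then have "indicator E (x(1 := y)) = (indicator (disc n) (x 0) * indicator (disc m) y :: complex)"
      unfolding E_def two by (auto simp: space_PiM PiE_iff extensional_def indicator_def)
    then show "?f (x(1 := y)) = indicator (disc n) (x 0) * (indicator (disc m) y *
        (of_real (measure \<mm> S) * of_real (measure \<mm> S) - energy (x 0 - y)))"
      by (simp add: correlation_def det_mat_2 kernel_diagonal kernel_energy)
  qed
  also have "\<dots> = (LINT x|\<mm>. LINT y|\<mm>. indicator (disc n) x * (indicator (disc m) y *
      (of_real (measure \<mm> S) * of_real (measure \<mm> S) - energy (x - y))))"
    by (rule product.product_integral_singleton) measurable
  also have "\<dots> = of_real (real q powi n * (real q powi m * (measure \<mm> S)\<^sup>2 - (measure \<mm> S - defect m)))"
    by (rule integral_pair_energy[OF assms])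
  finally have "expectation (\<lambda>\<omega>. count n \<omega> * count m \<omega> - count n \<omega>)
      = real q powi n * (real q powi m * (measure \<mm> S)\<^sup>2 - (measure \<mm> S - defect m))"
    using of_real_eq_iff by blast
  moreover have "expectation (\<lambda>\<omega>. count n \<omega> * count m \<omega> - count n \<omega>)
      = expectation (\<lambda>\<omega>. count n \<omega> * count m \<omega>) - real q powi n * measure \<mm> S"
    using int integrable_count by (simp add: expectation_count)
  ultimately show "expectation (\<lambda>\<omega>. count n \<omega> * count m \<omega>)
      = real q powi n * real q powi m * (measure \<mm> S)\<^sup>2 + real q powi n * defect m"
    by (simp add: algebra_simps)
qed

definition centred :: "int \<Rightarrow> 'w \<Rightarrow> real"
  where "centred k \<omega> = count k \<omega> - real q powi k * measure \<mm> S"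

text \<open>
  The two terms in which the full measure of \<open>S\<close> occurs cancel: the diagonal contributes
  \<open>q powi n * measure \<mm> S\<close> and the energy subtracts \<open>q powi n * (measure \<mm> S - defect m)\<close>.
\<close>

lemma covariance_count:
  assumes "n \<le> m"
  shows "integrable P (\<lambda>\<omega>. centred n \<omega> * centred m \<omega>)"
    and "expectation (\<lambda>\<omega>. centred n \<omega> * centred m \<omega>) = real q powi n * defect m"
proof -
  let ?a = "real q powi n * measure \<mm> S" and ?b = "real q powi m * measure \<mm> S"
  have eq: "centred n \<omega> * centred m \<omega> = count n \<omega> * count m \<omega> - ?a * count m \<omega> - ?b * count n \<omega> + ?a * ?b" for \<omega>
    by (simp add: centred_def algebra_simps)
  note int = integrable_count_mult[OF assms] integrable_count[of m] integrable_count[of n]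
  show "integrable P (\<lambda>\<omega>. centred n \<omega> * centred m \<omega>)"
    unfolding eq using int by simp
  have "expectation (\<lambda>\<omega>. centred n \<omega> * centred m \<omega>)
      = expectation (\<lambda>\<omega>. count n \<omega> * count m \<omega>) - ?a * expectation (count m) - ?b * expectation (count n) + ?a * ?b"
    unfolding eq using int by (simp add: prob_space)
  then show "expectation (\<lambda>\<omega>. centred n \<omega> * centred m \<omega>) = real q powi n * defect m"
    unfolding expectation_count expectation_count_mult[OF assms]
    by (simp add: power2_eq_square algebra_simps)
qed

end

section \<open>Averages of nearly uncorrelated random variables\<close>

lemma sum_half_powers: "(\<Sum>i<n. (1 / 2) ^ (n - i) :: real) \<le> 1"
proof (induction n)
  case (Suc n)
  have "(\<Sum>i<Suc n. (1 / 2) ^ (Suc n - i) :: real) = (\<Sum>i<Suc n. (1 / 2) * (1 / 2) ^ (n - i))"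
    by (intro sum.cong) (auto simp: Suc_diff_le)
  also have "\<dots> = (1 / 2) * ((\<Sum>i<n. (1 / 2) ^ (n - i)) + 1)"
    unfolding sum_distrib_left[symmetric] by simp
  finally show ?case
    using Suc by simp
qed simp

context prob_space
begin

text \<open>
  Passing from \<open>n\<close> to \<open>n + 1\<close> summands adds twice the covariances with the new variable, whose
  sum is at most \<open>C\<close> as a geometric series, and its variance, which is at most \<open>C\<close>.
\<close>

lemma second_moment_partial_sum:
  fixes Y :: "nat \<Rightarrow> 'a \<Rightarrow> real"
  assumes int: "\<And>i j. i \<le> j \<Longrightarrow> integrable M (\<lambda>\<omega>. Y i \<omega> * Y j \<omega>)"
    and cov: "\<And>i j. i \<le> j \<Longrightarrow> expectation (\<lambda>\<omega>. Y i \<omega> * Y j \<omega>) \<le> C * (1 / 2) ^ (j - i)"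
    and C: "0 \<le> C"
  shows "integrable M (\<lambda>\<omega>. (\<Sum>i<n. Y i \<omega>)\<^sup>2) \<and> expectation (\<lambda>\<omega>. (\<Sum>i<n. Y i \<omega>)\<^sup>2) \<le> 3 * C * n"
proof (induction n)
  case (Suc n)
  have eq: "(\<Sum>i<Suc n. Y i \<omega>)\<^sup>2 = (\<Sum>i<n. Y i \<omega>)\<^sup>2 + 2 * (\<Sum>i<n. Y i \<omega> * Y n \<omega>) + Y n \<omega> * Y n \<omega>" for \<omega>
    by (simp add: power2_eq_square algebra_simps sum_distrib_left)
  have intn: "integrable M (\<lambda>\<omega>. \<Sum>i<n. Y i \<omega> * Y n \<omega>)"
    using int by (intro Bochner_Integration.integrable_sum) auto
  have "expectation (\<lambda>\<omega>. (\<Sum>i<Suc n. Y i \<omega>)\<^sup>2)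
      = expectation (\<lambda>\<omega>. (\<Sum>i<n. Y i \<omega>)\<^sup>2) + 2 * expectation (\<lambda>\<omega>. \<Sum>i<n. Y i \<omega> * Y n \<omega>)
        + expectation (\<lambda>\<omega>. Y n \<omega> * Y n \<omega>)"
    unfolding eq using Suc intn int[of n n] by simp
  also have "expectation (\<lambda>\<omega>. \<Sum>i<n. Y i \<omega> * Y n \<omega>) = (\<Sum>i<n. expectation (\<lambda>\<omega>. Y i \<omega> * Y n \<omega>))"
    using int by (intro Bochner_Integration.integral_sum) auto
  also have "\<dots> \<le> (\<Sum>i<n. C * (1 / 2) ^ (n - i))"
    using cov by (intro sum_mono) auto
  also have "\<dots> = C * (\<Sum>i<n. (1 / 2) ^ (n - i))"
    by (simp add: sum_distrib_left)
  also have "\<dots> \<le> C * 1"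
    using sum_half_powers C by (intro mult_left_mono) auto
  also have "expectation (\<lambda>\<omega>. Y n \<omega> * Y n \<omega>) \<le> C"
    using cov[of n n] by simp
  finally have "expectation (\<lambda>\<omega>. (\<Sum>i<Suc n. Y i \<omega>)\<^sup>2) \<le> 3 * C * Suc n"
    using Suc by (simp add: algebra_simps)
  moreover have "integrable M (\<lambda>\<omega>. (\<Sum>i<Suc n. Y i \<omega>)\<^sup>2)"
    unfolding eq using Suc intn int[of n n] by simp
  ultimately show ?case
    by blast
qed simp

lemma averages_tendsto_0_subsequence:
  fixes Y :: "nat \<Rightarrow> 'a \<Rightarrow> real"
  assumes int: "\<And>i j. i \<le> j \<Longrightarrow> integrable M (\<lambda>\<omega>. Y i \<omega> * Y j \<omega>)"
    and cov: "\<And>i j. i \<le> j \<Longrightarrow> expectation (\<lambda>\<omega>. Y i \<omega> * Y j \<omega>) \<le> C * (1 / 2) ^ (j - i)"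
    and C: "0 \<le> C"
  shows "\<exists>r::nat \<Rightarrow> nat. strict_mono r \<and> (AE \<omega> in M. (\<lambda>n. (\<Sum>i<r n. Y i \<omega>) / r n) \<longlonglongrightarrow> 0)"
proof -
  define u where "u n \<omega> = ((\<Sum>i<n. Y i \<omega>) / real n)\<^sup>2" for n \<omega>
  have u: "u n \<omega> = (\<Sum>i<n. Y i \<omega>)\<^sup>2 / (real n)\<^sup>2" for n \<omega>
    by (simp add: u_def power_divide)
  note moment = second_moment_partial_sum[OF int cov C]
  have int_u: "integrable M (u n)" for n
    unfolding u[abs_def] using moment by simp
  have bound: "expectation (\<lambda>\<omega>. norm (u n \<omega>)) \<le> 3 * C / real n" for n
  proof (cases "n = 0")
    case False
    have "expectation (\<lambda>\<omega>. norm (u n \<omega>)) = expectation (\<lambda>\<omega>. (\<Sum>i<n. Y i \<omega>)\<^sup>2) / (real n)\<^sup>2"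
      by (simp add: u)
    also have "\<dots> \<le> (3 * C * n) / (real n)\<^sup>2"
      using moment by (intro divide_right_mono) auto
    also have "\<dots> = 3 * C / real n"
      using False by (simp add: power2_eq_square)
    finally show ?thesis .
  qed (simp add: u)
  have "(\<lambda>n. expectation (\<lambda>\<omega>. norm (u n \<omega>))) \<longlonglongrightarrow> 0"
  proof (rule tendsto_sandwich[where f = "\<lambda>_. 0" and h = "\<lambda>n. 3 * C / real n"])
    show "(\<lambda>n. 3 * C / real n) \<longlonglongrightarrow> 0"
      by (rule lim_const_over_n)
  qed (use bound in \<open>auto intro!: always_eventually\<close>)
  then obtain r :: "nat \<Rightarrow> nat" where r: "strict_mono r" "AE \<omega> in M. (\<lambda>n. u (r n) \<omega>) \<longlonglongrightarrow> 0"
    using tendsto_L1_AE_subseq[where u = u, OF int_u] by blast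
  have "AE \<omega> in M. (\<lambda>n. (\<Sum>i<r n. Y i \<omega>) / r n) \<longlonglongrightarrow> 0"
    using r(2)
  proof eventually_elim
    fix \<omega> assume "(\<lambda>n. u (r n) \<omega>) \<longlonglongrightarrow> 0"
    then have "(\<lambda>n. sqrt (u (r n) \<omega>)) \<longlonglongrightarrow> sqrt 0"
      by (rule tendsto_real_sqrt)
    then show "(\<lambda>n. (\<Sum>i<r n. Y i \<omega>) / r n) \<longlonglongrightarrow> 0"
      unfolding u_def real_sqrt_abs real_sqrt_zero tendsto_rabs_zero_iff .
  qed
  then show ?thesis
    using r(1) by blast
qed

end

section \<open>Number rigidity\<close>

lemma measurable_card_Int_config:
  fixes C :: "'a::metric_space set"
  assumes "C \<in> sets borel" "bounded C"
  shows "(\<lambda>A. real (card (A \<inter> C))) \<in> borel_measurable config_space"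
proof -
  have "(\<lambda>A. card (A \<inter> C)) \<in> measurable config_space (count_space UNIV)"
  proof (subst measurable_count_space_eq_countable)
    have "(\<lambda>A. card (A \<inter> C)) -` {k} \<inter> space config_space \<in> sets config_space" for k
    proof -
      have "(\<lambda>A. card (A \<inter> C)) -` {k} \<inter> space config_space = {A. locally_finite_set A \<and> card (A \<inter> C) = k}"
        by (auto simp: space_config_space)
      moreover have "{A. locally_finite_set A \<and> card (A \<inter> C) = k} \<in> sets config_space"
        unfolding config_space_def using assms by (intro in_measure_of) auto
      ultimately show ?thesis
        by simp
    qed
    then show "(\<lambda>A. card (A \<inter> C)) \<in> space config_space \<rightarrow> UNIV \<and>
        (\<forall>k\<in>UNIV. (\<lambda>A. card (A \<inter> C)) -` {k} \<inter> space config_space \<in> sets config_space)"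
      by blast
  qed simp
  then show ?thesis
    by measurable
qed

lemma sets_outside_algebra:
  "sets (outside_algebra P X B) = sigma_sets (space P)
    (sets (vimage_algebra (space P) (\<lambda>\<omega>. X \<omega> - B) config_space) \<union> null_sets (completion P))"
  and space_outside_algebra: "space (outside_algebra P X B) = space P"
proof -
  have "sets (vimage_algebra (space P) (\<lambda>\<omega>. X \<omega> - B) config_space) \<union> null_sets (completion P) \<subseteq> Pow (space P)"
    using sets.sets_into_space[of _ "vimage_algebra (space P) (\<lambda>\<omega>. X \<omega> - B) config_space"]
      sets.sets_into_space[of _ "completion P"]
    by (auto simp: null_sets_def)
  then show "sets (outside_algebra P X B) = sigma_sets (space P)
      (sets (vimage_algebra (space P) (\<lambda>\<omega>. X \<omega> - B) config_space) \<union> null_sets (completion P))"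
    and "space (outside_algebra P X B) = space P"
    unfolding outside_algebra_def by simp_all
qed

lemma measurable_outside_algebra:
  assumes "\<And>\<omega>. \<omega> \<in> space P \<Longrightarrow> locally_finite_set (X \<omega>)"
  shows "(\<lambda>\<omega>. X \<omega> - B) \<in> measurable (outside_algebra P X B) config_space"
proof (rule measurableI)
  fix \<omega> assume "\<omega> \<in> space (outside_algebra P X B)"
  then have "locally_finite_set (X \<omega>)"
    using assms by (simp add: space_outside_algebra)
  then have "locally_finite_set (X \<omega> - B)"
    unfolding locally_finite_set_def by (metis Diff_Int_distrib2 finite_Diff)
  then show "X \<omega> - B \<in> space config_space"
    by (simp add: space_config_space)
next
  fix A :: "'b set set" assume "A \<in> sets config_space"
  then have "(\<lambda>\<omega>. X \<omega> - B) -` A \<inter> space P \<in> sets (vimage_algebra (space P) (\<lambda>\<omega>. X \<omega> - B) config_space)"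
    by (rule in_vimage_algebra)
  then show "(\<lambda>\<omega>. X \<omega> - B) -` A \<inter> space (outside_algebra P X B) \<in> sets (outside_algebra P X B)"
    unfolding sets_outside_algebra space_outside_algebra by (intro sigma_sets.Basic) simp
qed

text \<open>
  This is where the completion by the null sets of \<open>P\<close> is used: the level sets of \<open>N\<close> and \<open>g\<close>
  differ by a subset of a null set.
\<close>

lemma measurable_outside_algebra_AE_eq:
  fixes N :: "'w \<Rightarrow> nat" and g :: "'w \<Rightarrow> real"
  assumes g: "g \<in> borel_measurable (outside_algebra P X B)"
    and eq: "AE \<omega> in P. real (N \<omega>) = g \<omega>"
  shows "N \<in> measurable (outside_algebra P X B) (count_space UNIV)"
proof (subst measurable_count_space_eq_countable)
  let ?G = "outside_algebra P X B"
  obtain Z where Z: "{\<omega> \<in> space P. real (N \<omega>) \<noteq> g \<omega>} \<subseteq> Z" "Z \<in> null_sets P"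
    using eq by (auto elim!: AE_E)
  have null: "A \<in> sets ?G" if "A \<subseteq> Z" for A
  proof -
    have "A \<in> null_sets (completion P)"
      using that Z(2) null_sets_completionI null_sets_completion_subset by blast
    then show ?thesis
      unfolding sets_outside_algebra by (intro sigma_sets.Basic) simp
  qed
  have "N -` {k} \<inter> space ?G \<in> sets ?G" for k
  proof -
    have "N -` {k} \<inter> space ?G = ((g -` {real k} \<inter> space ?G) - Z) \<union> (N -` {k} \<inter> space P \<inter> Z)"
      using Z(1) by (auto simp: space_outside_algebra)
    moreover have "g -` {real k} \<inter> space ?G \<in> sets ?G"
      using g by (rule measurable_sets) simp
    ultimately show ?thesis
      using null by (simp add: sets.Un sets.Diff)
  qed
  then show "N \<in> space ?G \<rightarrow> UNIV \<and> (\<forall>k\<in>UNIV. N -` {k} \<inter> space ?G \<in> sets ?G)"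
    by blast
qed simp

context set_process
begin

text \<open>
  The balls \<open>disc (l i)\<close> start so late that they contain \<open>B\<close> and that the bound applies. For
  \<open>i \<le> j\<close> the covariance of their counts is at most a constant times \<open>q powi (l i - l j)\<close>, hence
  times \<open>(1 / 2) ^ (j - i)\<close>, so the averages vanish in the limit along a subsequence \<open>r\<close>. The
  functions \<open>h n\<close> are the averages with the contribution of \<open>B\<close> removed and the sign reversed: they
  depend on \<open>X - B\<close> only, and they converge to the number of points in \<open>B\<close>.
\<close>

lemma number_rigid_if_defect_bound:
  assumes bound: "\<And>n. n \<ge> n0 \<Longrightarrow> defect (int n) \<le> C * real q powi (- int n)"
  shows "number_rigid P X"
  unfolding number_rigid_def
proof (intro allI impI)
  fix B :: "'a set" assume B: "open B \<and> bounded B"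
  obtain k where k: "k \<ge> 0" "B \<subseteq> disc k"
    using bounded_subset_disc B by blast
  define N where "N = max n0 (nat k)"
  define l where "l i = int (N + i)" for i
  have B_sub: "B \<subseteq> disc (l i)" for i
  proof -
    have "k \<le> l i"
      using k(1) by (simp add: l_def N_def)
    then show ?thesis
      using k(2) disc_mono[of k "l i"] by blast
  qed
  \<comment> \<open>an upper bound \<open>C\<close> may be negative, but the averaging lemma needs a nonnegative constant\<close>
  define D where "D = max C 0"
  have cov: "expectation (\<lambda>\<omega>. centred (l i) \<omega> * centred (l j) \<omega>) \<le> D * (1 / 2) ^ (j - i)"
    if "i \<le> j" for i j
  proof -
    have "expectation (\<lambda>\<omega>. centred (l i) \<omega> * centred (l j) \<omega>) = real q powi l i * defect (l j)"
      using that by (intro covariance_count) (simp add: l_def)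
    also have "\<dots> \<le> real q powi l i * (D * real q powi (- l j))"
    proof (rule mult_left_mono)
      have "defect (l j) \<le> C * real q powi (- l j)"
        unfolding l_def by (rule bound) (simp add: N_def)
      also have "\<dots> \<le> D * real q powi (- l j)"
        by (rule mult_right_mono) (simp_all add: D_def)
      finally show "defect (l j) \<le> D * real q powi (- l j)" .
    qed simp
    also have "\<dots> = D * (real q powi (l i + (- l j)))"
      using q_pos by (subst power_int_add) auto
    also have "l i + (- l j) = - int (j - i)"
      using that by (simp add: l_def)
    also have "real q powi (- int (j - i)) = (1 / real q) ^ (j - i)"
      by (simp add: power_int_minus power_one_over inverse_eq_divide)
    also have "D * (1 / real q) ^ (j - i) \<le> D * (1 / 2) ^ (j - i)"
      using q_ge_2 by (intro mult_left_mono power_mono) (auto simp: D_def field_simps)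
    finally show ?thesis .
  qed
  obtain r :: "nat \<Rightarrow> nat" where r: "strict_mono r"
    and lim: "AE \<omega> in P. (\<lambda>n. (\<Sum>i<r n. centred (l i) \<omega>) / r n) \<longlonglongrightarrow> 0"
    using averages_tendsto_0_subsequence[of "\<lambda>i. centred (l i)" D] covariance_count(1) cov
    by (force simp: l_def D_def)
  define c where "c i = real q powi l i * measure \<mm> S" for i
  define h where "h n \<omega> = (\<Sum>i<r n. c i - real (card ((X \<omega> - B) \<inter> disc (l i)))) / r n" for n \<omega>
  have "(\<lambda>\<omega>. real (card ((X \<omega> - B) \<inter> disc (l i)))) \<in> borel_measurable (outside_algebra P X B)" for i
    by (rule measurable_compose[OF measurable_outside_algebra[OF locally_finite_process]
          measurable_card_Int_config[OF borel_disc bounded_disc]])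
  then have h: "h n \<in> borel_measurable (outside_algebra P X B)" for n
    unfolding h_def by measurable
  have split: "count (l i) \<omega> = real (card (X \<omega> \<inter> B)) + real (card ((X \<omega> - B) \<inter> disc (l i)))"
    if "\<omega> \<in> space P" for i \<omega>
  proof -
    have eq: "X \<omega> \<inter> disc (l i) = (X \<omega> \<inter> B) \<union> ((X \<omega> - B) \<inter> disc (l i))"
      using B_sub by blast
    have "finite (X \<omega> \<inter> B)"
      using locally_finite_process[OF that] B by (simp add: locally_finite_set_def)
    moreover have "finite ((X \<omega> - B) \<inter> disc (l i))"
      by (rule finite_subset[OF _ finite_process_disc[OF that, of "l i"]]) blast
    moreover have "(X \<omega> \<inter> B) \<inter> ((X \<omega> - B) \<inter> disc (l i)) = {}"
      by blast
    ultimately have "card (X \<omega> \<inter> disc (l i)) = card (X \<omega> \<inter> B) + card ((X \<omega> - B) \<inter> disc (l i))"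
      unfolding eq by (rule card_Un_disjoint)
    then show ?thesis
      unfolding count_def by simp
  qed
  have "AE \<omega> in P. real (card (X \<omega> \<inter> B)) = lim (\<lambda>n. h n \<omega>)"
    using lim AE_space
  proof eventually_elim
    fix \<omega> assume conv: "(\<lambda>n. (\<Sum>i<r n. centred (l i) \<omega>) / r n) \<longlonglongrightarrow> 0" and \<omega>: "\<omega> \<in> space P"
    have "(\<lambda>n. real (card (X \<omega> \<inter> B)) - (\<Sum>i<r n. centred (l i) \<omega>) / r n) \<longlonglongrightarrow> real (card (X \<omega> \<inter> B)) - 0"
      by (intro tendsto_diff tendsto_const conv)
    moreover have "\<forall>\<^sub>F n in sequentially. real (card (X \<omega> \<inter> B)) - (\<Sum>i<r n. centred (l i) \<omega>) / r n = h n \<omega>"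
      \<comment> \<open>for \<open>n = 0\<close> the average may be empty, with value \<open>0 / 0 = 0\<close>\<close>
      using eventually_gt_at_top[of 0]
    proof eventually_elim
      fix n :: nat assume "0 < n"
      then have "r n > 0"
        using strict_mono_imp_increasing[OF r, of n] by simp
      moreover have "(\<Sum>i<r n. centred (l i) \<omega>)
          = real (r n) * real (card (X \<omega> \<inter> B)) - (\<Sum>i<r n. c i - real (card ((X \<omega> - B) \<inter> disc (l i))))"
        unfolding centred_def split[OF \<omega>] c_def by (simp add: sum.distrib sum_subtractf)
      ultimately show "real (card (X \<omega> \<inter> B)) - (\<Sum>i<r n. centred (l i) \<omega>) / r n = h n \<omega>"
        unfolding h_def by (simp add: diff_divide_distrib)
    qed
    ultimately have "(\<lambda>n. h n \<omega>) \<longlonglongrightarrow> real (card (X \<omega> \<inter> B))"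
      by (simp add: tendsto_cong)
    then show "real (card (X \<omega> \<inter> B)) = lim (\<lambda>n. h n \<omega>)"
      by (simp add: limI)
  qed
  then show "(\<lambda>\<omega>. card (X \<omega> \<inter> B)) \<in> measurable (outside_algebra P X B) (count_space UNIV)"
    using borel_measurable_lim_metric[OF h] by (rule measurable_outside_algebra_AE_eq[rotated])
qed

end

theorem theorem1p2:
  fixes \<pi> :: "'a::nonarch_local_field"
    and q :: nat
    and \<mm> :: "'a measure"
    and \<psi> :: "'a \<Rightarrow> complex"
    and S :: "'a set"
    and P :: "'w measure"
    and X :: "'w \<Rightarrow> 'a set"
  assumes "normalized_uniformizer \<pi>"
    and "q = card (residue_field :: 'a set set)"
    and "normalized_haar \<mm>"
    and "additive_character \<psi>"
    and "\<forall>x\<in>\<O>\<^sub>F. \<psi> x = 1"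
    and "\<not> \<psi> constant_on ((\<lambda>x. inverse \<pi> * x) ` \<O>\<^sub>F)"
    and "S \<in> sets borel"
    and "0 < emeasure \<mm> S" and "emeasure \<mm> S < \<infinity>"
    and "(\<lambda>n. 1 / measure \<mm> (cball 0 (inverse (real q ^ n))) *
            (LINT y:cball 0 (inverse (real q ^ n))|\<mm>. measure \<mm> (S - (\<lambda>s. s + y) ` S)))
          \<in> O(\<lambda>n. inverse (real q ^ n))"
    and "determinantal P X \<mm> (kernel_of_set \<mm> \<psi> S)"
  shows "number_rigid P X"
proof -
  interpret set_process \<pi> q \<mm> \<psi> S P X
    by unfold_locales (fact assms)+
  have ball: "cball 0 (inverse (real q ^ n)) = disc (- int n)" for n
    by (simp add: disc_def power_int_minus)
  have "1 / measure \<mm> (cball 0 (inverse (real q ^ n))) *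
      (LINT y:cball 0 (inverse (real q ^ n))|\<mm>. measure \<mm> (S - (\<lambda>s. s + y) ` S)) = defect (int n)" for n
    unfolding ball measure_disc defect_def by (simp add: power_int_minus divide_inverse)
  with assms(10) have "(\<lambda>n. defect (int n)) \<in> O(\<lambda>n. inverse (real q ^ n))"
    by simp
  then obtain C where "\<forall>\<^sub>F n in sequentially. norm (defect (int n)) \<le> C * norm (inverse (real q ^ n))"
    by (rule landau_o.bigE)
  then obtain n0 where "\<And>n. n \<ge> n0 \<Longrightarrow> norm (defect (int n)) \<le> C * norm (inverse (real q ^ n))"
    unfolding eventually_sequentially by blast
  then have "defect (int n) \<le> C * real q powi (- int n)" if "n \<ge> n0" for n
    using that by (fastforce simp: power_int_minus)
  then show ?thesis
    by (rule number_rigid_if_defect_bound)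
qed

end
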